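(* Let $A=(E/C,\gamma,a)$ be a cyclic algebra over $C$ of degree $d$. Let $\sigma$ be an automorphism of $A$ of finite order $n$ modulo inner automorphisms such that $\sigma|_C$ has order $n$, let $F=C\cap{\rm Fix}(\sigma)$, and let $u\in A^\times$ satisfy $\sigma^n(z)=uzu^{-1}$ for all $z\in A$ and $\sigma(u)=u$. Suppose that $\sigma|_E\in{\rm Aut}(E)$, $u\in E$, and $\gamma\circ\sigma=\sigma\circ\gamma$. Put $R=A[t;\sigma]$ and $x=u^{-1}t^n$, and let $N$ be the reduced norm of the central simple $F(x)$-algebra $A(t;\sigma)$. Let $f\in R$ be a polynomial of degree $m$ such that $(f,t)_r=1$, let $h(t)=\hat h(u^{-1}t^n)$ with $\hat h\in F[x]$ monic be its minimal central left multiple, and suppose that $\deg(\hat h)=dm$ (degree in $x$). (i) If $\hat h$ is irreducible in $F[x]$, then $f$ is irreducible in $R$. (ii) If $f$ is irreducible in $R$, then $N(f)$ is irreducible in $F[x]$.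
   Context: The cyclic algebra $(E/C,\gamma,a)$, with $E/C$ cyclic Galois of degree $d$, ${\rm Gal}(E/C)=\langle\gamma\rangle$, $a\in C^\times$, is $\bigoplus_{i=0}^{d-1}Ee^i$ with $e^d=a$ and $ez=\gamma(z)e$ for $z\in E$. $A[t;\sigma]$ is the skew polynomial ring with $tb=\sigma(b)t$ for $b\in A$; its center is $C(R)=F[x]$, $x=u^{-1}t^n$. The ring of central quotients $A(t;\sigma)=\{f/g : f\in R,\ 0\ne g\in F[x]\}$ is a central simple algebra of degree $dn$ over $F(x)$, $N$ is its reduced norm, and $N(f)\in F[x]$ for $f\in R$. ${\rm Fix}(\sigma)=\{b\in A:\sigma(b)=b\}$. An element $f$ of $R$ is irreducible if it is not a unit and is not a product $gq$ with $g,q\in R$ and $1\le\deg g,\deg q<\deg f$. $(f,t)_r$ is the greatest common right divisor of $f$ and $t$. The minimal central left multiple of $f$ is the unique polynomial $h\in C(R)$ of minimal degree such that $h=gf$ for some $g\in R$ and $h(t)=\hat h(u^{-1}t^n)$ with $\hat h\in F[x]$ monic.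
   Formalization: In (ii), A is additionally assumed to be a division algebra; without this (ii) fails, e.g. for A = M_2(Q), σ = id, u = 1, f = t − diag(1,2), which is irreducible by degree while N(f) = (x−1)(x−2). *)

theory Defs
  imports
    "Jordan_Normal_Form.Determinant"
    "HOL-Computational_Algebra.Polynomial_Factorial"
begin

section \<open>Noncommutative rings, subfields, bases\<close>

definition ring_unit :: "'a::ring_1 \<Rightarrow> bool" where
  "ring_unit u \<longleftrightarrow> (\<exists>v. u * v = 1 \<and> v * u = 1)"

definition ring_inv :: "'a::ring_1 \<Rightarrow> 'a" where
  "ring_inv u = (THE v. u * v = 1 \<and> v * u = 1)"

text \<open>Division is needed only for the implication from irreducibility of \<open>f\<close> to irreducibility of
  \<open>N(f)\<close>. When the degree on \<open>A[t;\<sigma>]\<close> is not additive that implication fails for the notion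
  of irreducibility that forbids only factors of intermediate degree: over the split quaternion
  algebra, with \<open>\<sigma> = id\<close>, \<open>n = 1\<close>, \<open>u = 1\<close> and \<open>d = 2\<close>, the polynomial \<open>f = t - diag(1,2)\<close> has no
  such factors, its minimal central left multiple is \<open>(x - 1)(x - 2)\<close>, of degree \<open>2 = d deg f\<close>, and
  \<open>N(f) = (x - 1)(x - 2)\<close>.\<close>

definition is_division_ring :: "'a::ring_1 itself \<Rightarrow> bool" where
  "is_division_ring _ \<longleftrightarrow> (\<forall>z::'a. z \<noteq> 0 \<longrightarrow> ring_unit z)"

definition is_subfield :: "'a::ring_1 set \<Rightarrow> bool" where
  "is_subfield K \<longleftrightarrow>
     0 \<in> K \<and> 1 \<in> K \<and>
     (\<forall>x\<in>K. \<forall>y\<in>K. x + y \<in> K \<and> x * y \<in> K \<and> x * y = y * x) \<and>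
     (\<forall>x\<in>K. - x \<in> K) \<and>
     (\<forall>x\<in>K. x \<noteq> 0 \<longrightarrow> (\<exists>y\<in>K. x * y = 1))"

text \<open>The elements \<open>b 0, \<dots>, b (k - 1)\<close> form a basis of \<open>V\<close> as a left vector space over the
  subfield \<open>K\<close>.\<close>

definition left_basis :: "'a::ring_1 set \<Rightarrow> 'a set \<Rightarrow> nat \<Rightarrow> (nat \<Rightarrow> 'a) \<Rightarrow> bool" where
  "left_basis K V k b \<longleftrightarrow>
     (\<forall>i<k. b i \<in> V) \<and>
     (\<forall>v\<in>V. \<exists>!c. (\<forall>i<k. c i \<in> K) \<and> (\<forall>i\<ge>k. c i = 0) \<and> v = (\<Sum>i<k. c i * b i))"

section \<open>Cyclic algebras\<close>

text \<open>Automorphisms of the subfield \<open>E\<close> are represented by functions on the whole ring of which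
  only the values on \<open>E\<close> matter.\<close>

definition Gal :: "'a::ring_1 set \<Rightarrow> 'a set \<Rightarrow> ('a \<Rightarrow> 'a) set" where
  "Gal E C = {\<tau>. bij_betw \<tau> E E \<and>
     (\<forall>x\<in>E. \<forall>y\<in>E. \<tau> (x + y) = \<tau> x + \<tau> y \<and> \<tau> (x * y) = \<tau> x * \<tau> y) \<and>
     (\<forall>c\<in>C. \<tau> c = c)}"

definition cyclic_galois :: "'a::ring_1 set \<Rightarrow> 'a set \<Rightarrow> ('a \<Rightarrow> 'a) \<Rightarrow> nat \<Rightarrow> bool" where
  "cyclic_galois E C \<gamma> d \<longleftrightarrow>
     is_subfield E \<and> is_subfield C \<and> C \<subseteq> E \<and>
     (\<exists>b. left_basis C E d b) \<and>
     {z \<in> E. \<forall>\<tau>\<in>Gal E C. \<tau> z = z} = C \<and>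
     \<gamma> \<in> Gal E C \<and> (\<forall>\<tau>\<in>Gal E C. \<exists>i. \<forall>z\<in>E. \<tau> z = (\<gamma> ^^ i) z)"

text \<open>The whole type \<open>'a\<close> is the cyclic algebra \<open>(E/C, \<gamma>, a)\<close> of degree \<open>d\<close> with
  distinguished generator \<open>e\<close>.\<close>

definition cyclic_algebra ::
  "'a::ring_1 set \<Rightarrow> 'a set \<Rightarrow> ('a \<Rightarrow> 'a) \<Rightarrow> nat \<Rightarrow> 'a \<Rightarrow> 'a \<Rightarrow> bool" where
  "cyclic_algebra E C \<gamma> d a e \<longleftrightarrow>
     cyclic_galois E C \<gamma> d \<and> a \<in> C \<and> a \<noteq> 0 \<and>
     e ^ d = a \<and> (\<forall>z\<in>E. e * z = \<gamma> z * e) \<and>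
     left_basis E UNIV d (\<lambda>i. e ^ i)"

section \<open>Automorphisms\<close>

definition ring_automorphism :: "('a::ring_1 \<Rightarrow> 'a) \<Rightarrow> bool" where
  "ring_automorphism \<sigma> \<longleftrightarrow> Ring_Hom.ring_hom \<sigma> \<and> bij \<sigma>"

definition inner_automorphism :: "('a::ring_1 \<Rightarrow> 'a) \<Rightarrow> bool" where
  "inner_automorphism \<tau> \<longleftrightarrow> (\<exists>v. ring_unit v \<and> (\<forall>z. \<tau> z = v * z * ring_inv v))"

definition order_mod_inner :: "('a::ring_1 \<Rightarrow> 'a) \<Rightarrow> nat \<Rightarrow> bool" where
  "order_mod_inner \<sigma> n \<longleftrightarrow>
     0 < n \<and> inner_automorphism (\<sigma> ^^ n) \<and> (\<forall>i. 0 < i \<and> i < n \<longrightarrow> \<not> inner_automorphism (\<sigma> ^^ i))"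

definition order_on :: "'a set \<Rightarrow> ('a \<Rightarrow> 'a) \<Rightarrow> nat \<Rightarrow> bool" where
  "order_on C \<sigma> n \<longleftrightarrow>
     0 < n \<and> \<sigma> ` C = C \<and> (\<forall>c\<in>C. (\<sigma> ^^ n) c = c) \<and>
     (\<forall>i. 0 < i \<and> i < n \<longrightarrow> \<not> (\<forall>c\<in>C. (\<sigma> ^^ i) c = c))"

section \<open>The skew polynomial ring\<close>

text \<open>The additive group of \<open>R = A[t;\<sigma>]\<close> is the type \<open>'a poly\<close>, coefficients being written on
  the left of the powers of \<open>t\<close>; the product is determined by \<open>t b = \<sigma>(b) t\<close>. The library
  product on \<open>'a poly\<close> (which exists only for commutative \<open>'a\<close>) is never used on \<open>R\<close>.\<close>

definition skew_times :: "('a::ring_1 \<Rightarrow> 'a) \<Rightarrow> 'a poly \<Rightarrow> 'a poly \<Rightarrow> 'a poly" where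
  "skew_times \<sigma> f g =
     (\<Sum>i\<le>degree f. \<Sum>j\<le>degree g. monom (coeff f i * (\<sigma> ^^ i) (coeff g j)) (i + j))"

definition skew_power :: "('a::ring_1 \<Rightarrow> 'a) \<Rightarrow> 'a poly \<Rightarrow> nat \<Rightarrow> 'a poly" where
  "skew_power \<sigma> f k = (skew_times \<sigma> f ^^ k) [:1:]"

definition skew_unit :: "('a::ring_1 \<Rightarrow> 'a) \<Rightarrow> 'a poly \<Rightarrow> bool" where
  "skew_unit \<sigma> f \<longleftrightarrow> (\<exists>g. skew_times \<sigma> f g = [:1:] \<and> skew_times \<sigma> g f = [:1:])"

definition skew_irreducible :: "('a::ring_1 \<Rightarrow> 'a) \<Rightarrow> 'a poly \<Rightarrow> bool" where
  "skew_irreducible \<sigma> f \<longleftrightarrow> \<not> skew_unit \<sigma> f \<and>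
     \<not> (\<exists>g q. f = skew_times \<sigma> g q \<and>
          1 \<le> degree g \<and> degree g < degree f \<and> 1 \<le> degree q \<and> degree q < degree f)"

definition right_divides :: "('a::ring_1 \<Rightarrow> 'a) \<Rightarrow> 'a poly \<Rightarrow> 'a poly \<Rightarrow> bool" where
  "right_divides \<sigma> g f \<longleftrightarrow> (\<exists>q. f = skew_times \<sigma> q g)"

definition is_gcrd :: "('a::ring_1 \<Rightarrow> 'a) \<Rightarrow> 'a poly \<Rightarrow> 'a poly \<Rightarrow> 'a poly \<Rightarrow> bool" where
  "is_gcrd \<sigma> f g r \<longleftrightarrow> right_divides \<sigma> r f \<and> right_divides \<sigma> r g \<and>
     (\<forall>s. right_divides \<sigma> s f \<and> right_divides \<sigma> s g \<longrightarrow> right_divides \<sigma> s r)"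

text \<open>The field \<open>F\<close> is given as a type \<open>'f\<close> with an embedding \<open>\<iota>\<close> into \<open>A\<close>, so that \<open>F[x]\<close> is
  \<open>'f poly\<close> and \<open>F(x)\<close> is \<open>'f poly fract\<close>. The element \<open>central_eval \<sigma> \<iota> u n p\<close> of \<open>R\<close>
  is \<open>p(x)\<close> for \<open>x = u\<^sup>-\<^sup>1 t\<^sup>n\<close>.\<close>

definition central_eval ::
  "('a::ring_1 \<Rightarrow> 'a) \<Rightarrow> ('f::field \<Rightarrow> 'a) \<Rightarrow> 'a \<Rightarrow> nat \<Rightarrow> 'f poly \<Rightarrow> 'a poly" where
  "central_eval \<sigma> \<iota> u n p =
     (\<Sum>k\<le>degree p. skew_times \<sigma> [:\<iota> (coeff p k):] (skew_power \<sigma> (monom (ring_inv u) n) k))"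

definition is_min_central_left_multiple ::
  "('a::ring_1 \<Rightarrow> 'a) \<Rightarrow> ('f::field \<Rightarrow> 'a) \<Rightarrow> 'a \<Rightarrow> nat \<Rightarrow> 'a poly \<Rightarrow> 'f poly \<Rightarrow> bool" where
  "is_min_central_left_multiple \<sigma> \<iota> u n f hh \<longleftrightarrow>
     lead_coeff hh = 1 \<and> right_divides \<sigma> f (central_eval \<sigma> \<iota> u n hh) \<and>
     (\<forall>p. lead_coeff p = 1 \<and> right_divides \<sigma> f (central_eval \<sigma> \<iota> u n p) \<longrightarrow>
        degree (central_eval \<sigma> \<iota> u n hh) \<le> degree (central_eval \<sigma> \<iota> u n p))"

section \<open>Central quotients and the reduced norm\<close>

text \<open>The type \<open>'b\<close> is the ring \<open>A(t;\<sigma>)\<close> of all quotients \<open>f/g\<close> with \<open>f \<in> R\<close> and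
  \<open>0 \<noteq> g \<in> F[x]\<close>; \<open>j\<close> embeds \<open>R\<close> and \<open>s\<close> embeds \<open>F(x)\<close>. These conditions determine
  \<open>('b, j, s)\<close> up to unique isomorphism.\<close>

definition is_central_quotient_ring ::
  "('a::ring_1 \<Rightarrow> 'a) \<Rightarrow> ('f::field \<Rightarrow> 'a) \<Rightarrow> 'a \<Rightarrow> nat \<Rightarrow>
   ('a poly \<Rightarrow> 'b::ring_1) \<Rightarrow> ('f poly fract \<Rightarrow> 'b) \<Rightarrow> bool" where
  "is_central_quotient_ring \<sigma> \<iota> u n j s \<longleftrightarrow>
     inj j \<and> j [:1:] = 1 \<and>
     (\<forall>f g. j (f + g) = j f + j g \<and> j (skew_times \<sigma> f g) = j f * j g) \<and>
     Ring_Hom.ring_hom s \<and>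
     (\<forall>p. s (to_fract p) = j (central_eval \<sigma> \<iota> u n p)) \<and>
     (\<forall>b. \<exists>f g. g \<noteq> 0 \<and> b = j f * s (inverse (to_fract g)))"

text \<open>Let \<open>B\<close> (the type \<open>'b\<close>) be an algebra over the field \<open>Z\<close> (the type \<open>'z\<close>) with
  structure map \<open>s\<close>, and let \<open>i\<close> embed \<open>Z\<close> into the field \<open>K\<close> (the type \<open>'k\<close>).
  A homomorphism \<open>\<phi>\<close> of \<open>Z\<close>-algebras from \<open>B\<close> to the \<open>k \<times> k\<close> matrices over \<open>K\<close> is a splitting
  if its \<open>K\<close>-linear extension is an isomorphism from \<open>B \<otimes>\<^sub>Z K\<close> onto the full matrix algebra,
  that is, if it maps a \<open>Z\<close>-basis of \<open>B\<close> to a \<open>K\<close>-basis of the matrix algebra.\<close>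

definition is_splitting ::
  "('z::field \<Rightarrow> 'b::ring_1) \<Rightarrow> nat \<Rightarrow> ('z \<Rightarrow> 'k::field) \<Rightarrow> ('b \<Rightarrow> 'k mat) \<Rightarrow> bool" where
  "is_splitting s k i \<phi> \<longleftrightarrow>
     field_hom i \<and>
     (\<forall>y. \<phi> y \<in> carrier_mat k k) \<and> \<phi> 1 = 1\<^sub>m k \<and>
     (\<forall>y y'. \<phi> (y + y') = \<phi> y + \<phi> y' \<and> \<phi> (y * y') = \<phi> y * \<phi> y') \<and>
     (\<forall>z. \<phi> (s z) = i z \<cdot>\<^sub>m 1\<^sub>m k) \<and>
     (\<exists>b. left_basis (range s) UNIV (k ^ 2) b \<and>
        (\<forall>M\<in>carrier_mat k k. \<exists>!c. (\<forall>l\<ge>k ^ 2. c l = 0) \<and>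
           (\<forall>p<k. \<forall>q<k. M $$ (p, q) = (\<Sum>l<k ^ 2. c l * \<phi> (b l) $$ (p, q)))))"

text \<open>\<open>N\<close> is the reduced norm of the central simple \<open>Z\<close>-algebra \<open>B\<close> of degree \<open>k\<close>, computed
  as the determinant over a splitting field \<open>K\<close>. By the Skolem--Noether theorem and Galois descent,
  such an \<open>N\<close> with values in \<open>Z\<close> exists for every splitting field and does not depend on the choice
  of the splitting field or of the splitting.\<close>

definition is_reduced_norm ::
  "'k::field itself \<Rightarrow> ('z::field \<Rightarrow> 'b::ring_1) \<Rightarrow> nat \<Rightarrow> ('b \<Rightarrow> 'z) \<Rightarrow> bool" where
  "is_reduced_norm _ s k N \<longleftrightarrow>
     (\<exists>(i :: 'z \<Rightarrow> 'k) \<phi>. is_splitting s k i \<phi> \<and> (\<forall>y. i (N y) = det (\<phi> y)))"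

end

theory Submission
  imports Defs
begin

text \<open>The reduced norm of \<open>f \<in> R\<close> is a polynomial in \<open>x\<close> of degree at most \<open>d deg f\<close>. Indeed \<open>R\<close> is
  generated over \<open>F[x]\<close> by finitely many elements, with coefficients of degree at most \<open>deg f / n\<close>;
  expanding the determinant of \<open>f\<^sup>q\<close> in these coefficients and projecting the splitting field
  linearly onto \<open>F(x)\<close> shows that \<open>D N(f)\<^sup>q\<close> is, for some \<open>D \<noteq> 0\<close> independent of \<open>q\<close>, a polynomial of
  degree at most \<open>q d deg f + O(1)\<close>. Letting \<open>q\<close> grow gives both claims.

  If \<open>h\<close> is irreducible and \<open>f = g r\<close> properly, then \<open>N(g)\<close> and \<open>N(r)\<close> divide a power of \<open>h\<close> and have
  degree less than \<open>deg h\<close>, so \<open>N(f)\<close> is a constant. The adjugate of \<open>f\<^sup>q\<close> then bounds the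
  denominators of all powers of \<open>f\<^sup>-\<^sup>1\<close> by one \<open>D\<close>, so that \<open>D \<in> R f\<^sup>q\<close> for all \<open>q\<close>; an \<open>F\<close>-linear
  relation between the powers of \<open>f\<close> modulo \<open>D\<close> gives \<open>1 \<in> R f\<close>, which contradicts the minimality
  of \<open>h\<close>.

  If \<open>f\<close> is irreducible and \<open>A\<close> is a division algebra, then \<open>R f\<close> is a maximal left ideal, which makes
  \<open>h\<close> irreducible; as \<open>N(f)\<close> divides a power of \<open>h\<close> and the degree bounds for the two factors of
  \<open>h = g f\<close> are attained, \<open>N(f)\<close> is associated to \<open>h\<close>.\<close>

section \<open>Denominators of rational functions\<close>

text \<open>Unless \<open>h\<close> divides \<open>p\<close>, it divides the cofactor of
  \<open>p\<close> in \<open>h ^ k\<close>; cancelling it there lowers \<open>k\<close>.\<close>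

lemma prime_elem_power_cofactor:
  fixes h :: "'a::idom"
  assumes "prime_elem h" "p dvd h ^ k"
  shows "p dvd 1 \<or> h dvd p"
  using assms(2)
proof (induction k)
  case (Suc k)
  then obtain b where b: "h * h ^ k = p * b" by (auto elim: dvdE)
  have "h dvd p * b" unfolding b[symmetric] by simp
  then consider "h dvd p" | "h dvd b" using assms(1) by (auto dest: prime_elem_dvd_multD)
  then show ?case
  proof cases
    case 2
    then obtain b' where "b = h * b'" ..
    then have "h * h ^ k = h * (p * b')" using b by (simp add: ac_simps)
    then have "h ^ k = p * b'" using assms(1) by (auto simp: prime_elem_def)
    then show ?thesis using Suc.IH by simp
  qed simp
qed simp

text \<open>Each factor \<open>h\<close> must come from \<open>D\<close>, because \<open>p\<close>
  supplies none. Cancelling it changes \<open>D\<close>, which therefore varies in the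
  induction.\<close>

lemma prime_elem_power_dvd_mult_power:
  fixes h :: "'a::idom"
  assumes "prime_elem h" "\<not> h dvd p" "h ^ k dvd D * p ^ l"
  shows "h ^ k dvd D"
  using assms(3)
proof (induction k arbitrary: D)
  case (Suc k)
  have "h dvd D * p ^ l" using Suc.prems by (auto intro: dvd_mult_left)
  then have "h dvd D"
    using assms(1,2) prime_elem_dvd_multD prime_elem_dvd_power by blast
  then obtain D' where D': "D = h * D'" ..
  then have "h ^ k dvd D' * p ^ l"
    using Suc.prems assms(1) by (simp add: prime_elem_def mult.assoc)
  then have "h ^ k dvd D'" by (rule Suc.IH)
  then show ?case unfolding D' by (simp add: mult_dvd_mono)
qed simp

lemma exists_prime_elem_dvd_poly:
  fixes Q :: "'f::field poly"
  assumes "Q \<noteq> 0" "degree Q > 0"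
  shows "\<exists>h. prime_elem h \<and> h dvd Q"
  using assms
proof (induction "degree Q" arbitrary: Q rule: less_induct)
  case less
  show ?case
  proof (cases "irreducible Q")
    case True
    then show ?thesis using field_poly_irreducible_imp_prime[OF True] dvd_refl by blast
  next
    case False
    have "\<not> is_unit Q" using less.prems by (simp add: is_unit_iff_degree)
    with False obtain a b where ab: "Q = a * b" "\<not> is_unit a" "\<not> is_unit b"
      using less.prems(1) irreducibleI[of Q] by metis
    then have "a \<noteq> 0" "b \<noteq> 0" using less.prems by auto
    then have deg: "degree a > 0" "degree b > 0" "degree Q = degree a + degree b"
      unfolding ab(1) using ab(2,3) is_unit_iff_degree[of a] is_unit_iff_degree[of b]
      by (blast, blast, metis degree_mult_eq)
    then obtain h where "prime_elem h" "h dvd a" using less.hyps[of a] \<open>a \<noteq> 0\<close> by fastforce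
    then show ?thesis using ab(1) dvd_mult2 by blast
  qed
qed

lemma to_fract_power: "to_fract (x ^ q) = to_fract x ^ q"
  by (induction q) simp_all

lemma fract_eq_to_fract_divide:
  fixes z :: "'r::idom fract"
  obtains P Q where "Q \<noteq> 0" "z = to_fract P / to_fract Q"
  by (cases z) (auto simp: Fract_conv_to_fract)

lemma common_denominator:
  fixes z :: "'i \<Rightarrow> 'r::idom fract"
  assumes "finite I"
  shows "\<exists>D. D \<noteq> 0 \<and> (\<forall>i\<in>I. \<exists>P. to_fract D * z i = to_fract P)"
  using assms
proof (induction I)
  case empty
  show ?case by (rule exI[of _ 1]) simp
next
  case (insert i I)
  then obtain D where D: "D \<noteq> 0" "\<And>i. i \<in> I \<Longrightarrow> \<exists>P. to_fract D * z i = to_fract P" by auto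
  obtain P Q where PQ: "Q \<noteq> 0" "z i = to_fract P / to_fract Q" by (rule fract_eq_to_fract_divide)
  have "to_fract (D * Q) * z i = to_fract (D * P)" using PQ by simp
  moreover have "\<exists>P. to_fract (D * Q) * z i' = to_fract P" if i': "i' \<in> I" for i'
  proof -
    obtain P where "to_fract D * z i' = to_fract P" using D(2) i' by blast
    then have "to_fract (D * Q) * z i' = to_fract (Q * P)" by simp
    then show ?thesis by blast
  qed
  ultimately have "\<forall>i'\<in>insert i I. \<exists>P. to_fract (D * Q) * z i' = to_fract P" by blast
  then show ?case using D(1) PQ(1) by (intro exI[of _ "D * Q"]) simp
qed

text \<open>This is complete integral closedness of F[x]. In a representation P/Q with deg Q least,
  a prime \<open>h\<close> dividing Q cannot divide P, so a common denominator \<open>D\<close> of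
  all powers would be divisible by every power of \<open>h\<close>.\<close>

lemma polynomial_if_powers_bounded_denominator:
  fixes z :: "'f::field poly fract"
  assumes D: "D \<noteq> 0" and bd: "\<And>q. \<exists>W. to_fract D * z ^ q = to_fract W"
  shows "\<exists>p. z = to_fract p"
proof -
  define good where "good m \<longleftrightarrow> (\<exists>P Q. Q \<noteq> 0 \<and> z = to_fract P / to_fract Q \<and> degree Q = m)" for m
  define m where "m = (LEAST m. good m)"
  have "\<exists>m. good m" unfolding good_def using fract_eq_to_fract_divide[of z] by metis
  then have "good m" and least: "\<And>m'. good m' \<Longrightarrow> m \<le> m'"
    unfolding m_def by (auto intro: LeastI Least_le)
  then obtain P Q where PQ: "Q \<noteq> 0" "z = to_fract P / to_fract Q" "degree Q = m"
    unfolding good_def by auto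
  show ?thesis
  proof (cases "m = 0")
    case True
    then obtain c where "Q = [:c:]" "c \<noteq> 0" using PQ by (metis degree_eq_zeroE pCons_eq_0_iff)
    then have "Q * [:inverse c:] = 1" by (simp add: one_pCons)
    then have "to_fract Q * to_fract [:inverse c:] = 1"
      by (metis to_fract_mult to_fract_1)
    then have "1 / to_fract Q = to_fract [:inverse c:]"
      using PQ(1) by (simp add: field_simps)
    then have "z = to_fract (P * [:inverse c:])"
      using PQ(2) by (metis divide_inverse inverse_eq_divide to_fract_mult)
    then show ?thesis by blast
  next
    case False
    then obtain h where h: "prime_elem h" "h dvd Q"
      using exists_prime_elem_dvd_poly[of Q] PQ by auto
    then obtain Q' where Q': "Q = h * Q'" by auto
    have h0: "h \<noteq> 0" "Q' \<noteq> 0" using Q' PQ by auto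
    have hdeg: "degree h > 0" using h h0 by (auto simp: prime_elem_def is_unit_iff_degree)
    show ?thesis
    proof (cases "h dvd P")
      case True
      then obtain P' where "P = h * P'" ..
      then have "z = to_fract P' / to_fract Q'" using PQ Q' h0 by simp
      then have "good (degree Q')" unfolding good_def using h0 by blast
      then have "m \<le> degree Q'" by (rule least)
      then show ?thesis using Q' h0 hdeg PQ(3) by (simp add: degree_mult_eq)
    next
      case False
      \<comment> \<open>Since \<open>h\<close> has positive degree, \<open>h ^ q\<close> has larger
        degree than \<open>D\<close>.\<close>
      define q where "q = Suc (degree D)"
      obtain W where "to_fract D * z ^ q = to_fract W" using bd by blast
      then have "to_fract (D * P ^ q) = to_fract (Q ^ q * W)"
        using PQ(1,2) by (simp add: to_fract_power power_divide field_simps)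
      then have "D * P ^ q = Q ^ q * W" by (simp only: to_fract_eq_iff)
      then have "h ^ q dvd D * P ^ q" by (simp add: Q' power_mult_distrib)
      then have "h ^ q dvd D" using prime_elem_power_dvd_mult_power h False by blast
      then have "degree (h ^ q) \<le> degree D" using D by (rule dvd_imp_degree_le)
      then have "q * degree h \<le> degree D" using h0 by (simp add: degree_power_eq)
      then show ?thesis using hdeg unfolding q_def
        by (metis Suc_leI less_le_trans mult_le_mono2 mult.right_neutral not_less_eq_eq order_refl One_nat_def le_trans)
    qed
  qed
qed

section \<open>Linear algebra\<close>

text \<open>Gaussian elimination, by induction on the equations: an equation with a nonzero
  coefficient costs one unknown, one with all coefficients zero costs none.\<close>

lemma homogeneous_system_nontrivial_solution:
  fixes A :: "'i \<Rightarrow> 'j \<Rightarrow> 'k::field"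
  assumes "finite I" "finite J" "card I < card J"
  shows "\<exists>z. (\<exists>j\<in>J. z j \<noteq> 0) \<and> (\<forall>i\<in>I. (\<Sum>j\<in>J. A i j * z j) = 0)"
  using assms
proof (induction I arbitrary: J A)
  case empty
  then show ?case by (intro exI[of _ "\<lambda>_. 1"]) (auto simp: card_gt_0_iff)
next
  case (insert i I)
  show ?case
  proof (cases "\<exists>l\<in>J. A i l \<noteq> 0")
    case False
    with insert.IH[of J A] insert.prems insert.hyps show ?thesis by auto
  next
    case True
    then obtain l where l: "l \<in> J" "A i l \<noteq> 0" by blast
    \<comment> \<open>Subtracting a multiple of equation \<open>i\<close> removes the unknown
      \<open>l\<close> from the other equations.\<close>
    define A' where "A' i' j = A i' j - A i' l * A i j / A i l" for i' j
    have "card I < card (J - {l})" using insert.prems insert.hyps l by simp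
    then obtain z where z: "\<exists>j\<in>J - {l}. z j \<noteq> 0"
        "\<And>i'. i' \<in> I \<Longrightarrow> (\<Sum>j\<in>J - {l}. A' i' j * z j) = 0"
      using insert.IH[of "J - {l}" A'] insert.prems by auto
    \<comment> \<open>The value of the unknown \<open>l\<close> that equation \<open>i\<close>
      forces.\<close>
    define zl where "zl = - (\<Sum>j\<in>J - {l}. A i j * z j) / A i l"
    define z' where "z' = z(l := zl)"
    have sum: "(\<Sum>j\<in>J. A i' j * z' j) = A i' l * zl + (\<Sum>j\<in>J - {l}. A i' j * z j)" for i'
      unfolding z'_def using l insert.prems by (subst sum.remove[of _ l]) auto
    have "(\<Sum>j\<in>J. A i j * z' j) = 0" using l unfolding sum zl_def by simp
    moreover have "(\<Sum>j\<in>J. A i' j * z' j) = 0" if "i' \<in> I" for i'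
    proof -
      have "0 = (\<Sum>j\<in>J - {l}. A i' j * z j) - (A i' l / A i l) * (\<Sum>j\<in>J - {l}. A i j * z j)"
        using z(2)[OF that] unfolding A'_def
        by (simp add: algebra_simps sum_subtractf sum_distrib_left)
      then show ?thesis unfolding sum zl_def by simp
    qed
    moreover have "\<exists>j\<in>J. z' j \<noteq> 0" using z(1) unfolding z'_def by auto
    ultimately show ?thesis by blast
  qed
qed

text \<open>The determinant is linear in each row, and \<open>\<alpha>\<close> records which summand
  each row contributes. The varying weights \<open>w\<close> are thus separated from the fixed data
  \<open>G\<close>.\<close>

lemma det_linear_combination:
  fixes G :: "'i \<Rightarrow> nat \<Rightarrow> nat \<Rightarrow> 'k::comm_ring_1"
  assumes "finite I"
  shows "det (mat k k (\<lambda>(r, c). \<Sum>l\<in>I. w l * G l r c)) =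
    (\<Sum>\<alpha>\<in>{0..<k} \<rightarrow>\<^sub>E I. (\<Prod>r=0..<k. w (\<alpha> r)) * det (mat k k (\<lambda>(r, c). G (\<alpha> r) r c)))"
proof -
  let ?P = "{p. p permutes {0..<k}}" and ?A = "{0..<k} \<rightarrow>\<^sub>E I"
  have "det (mat k k (\<lambda>(r, c). \<Sum>l\<in>I. w l * G l r c)) =
    (\<Sum>p\<in>?P. signof p * (\<Prod>r=0..<k. \<Sum>l\<in>I. w l * G l r (p r)))"
    by (subst det_def'[of _ k]) (auto intro!: sum.cong prod.cong simp: permutes_in_image)
  also have "\<dots> = (\<Sum>p\<in>?P. \<Sum>\<alpha>\<in>?A. (\<Prod>r=0..<k. w (\<alpha> r)) *
      (signof p * (\<Prod>r=0..<k. G (\<alpha> r) r (p r))))"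
    by (simp add: prod_sum_PiE sum_distrib_left prod.distrib ac_simps assms)
  also have "\<dots> = (\<Sum>\<alpha>\<in>?A. (\<Prod>r=0..<k. w (\<alpha> r)) *
      (\<Sum>p\<in>?P. signof p * (\<Prod>r=0..<k. G (\<alpha> r) r (p r))))"
    by (subst sum.swap) (simp add: sum_distrib_left)
  also have "\<dots> = (\<Sum>\<alpha>\<in>?A. (\<Prod>r=0..<k. w (\<alpha> r)) * det (mat k k (\<lambda>(r, c). G (\<alpha> r) r c)))"
    by (subst det_def'[of _ k]) (auto intro!: sum.cong prod.cong simp: permutes_in_image)
  finally show ?thesis .
qed

text \<open>The larger field is a vector space over the smaller one, possibly of infinite dimension.
  The set {1} is independent, so the assignment of 1 to 1 extends to a linear map.\<close>

lemma exists_linear_retraction: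
  fixes i :: "'z::field \<Rightarrow> 'k::field"
  assumes "field_hom i"
  obtains \<rho> where "\<And>x y. \<rho> (x + y) = \<rho> x + \<rho> y" "\<And>z x. \<rho> (i z * x) = z * \<rho> x" "\<rho> 1 = 1"
proof -
  interpret i: field_hom i by fact
  interpret vector_space_pair "\<lambda>z x. i z * x" "\<lambda>z x::'z. z * x"
    by unfold_locales (auto simp: algebra_simps hom_distribs)
  have "vs1.independent {1}" by simp
  then obtain g where g: "Vector_Spaces.linear (\<lambda>z x. i z * x) (\<lambda>z x. z * x) g" "g 1 = 1"
    using linear_independent_extend[of "{1}" "\<lambda>_. 1"] by auto
  interpret g: Vector_Spaces.linear "\<lambda>z x. i z * x" "\<lambda>z x::'z. z * x" g by fact
  show ?thesis using that[of g] g(2) g.add g.scale by auto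
qed

section \<open>The skew polynomial ring inside its ring of central quotients\<close>

lemma skew_times_eq_sum:
  assumes "\<sigma> 0 = 0" "degree f \<le> k" "degree g \<le> l"
  shows "skew_times \<sigma> f g = (\<Sum>i\<le>k. \<Sum>j\<le>l. monom (coeff f i * (\<sigma> ^^ i) (coeff g j)) (i + j))"
proof -
  have [simp]: "(\<sigma> ^^ i) 0 = 0" for i by (induction i) (simp_all add: assms(1))
  have "skew_times \<sigma> f g =
      (\<Sum>i\<le>degree f. \<Sum>j\<le>l. monom (coeff f i * (\<sigma> ^^ i) (coeff g j)) (i + j))"
    unfolding skew_times_def using assms(3)
    by (intro sum.cong refl sum.mono_neutral_left) (auto simp: coeff_eq_0)
  also have "\<dots> = (\<Sum>i\<le>k. \<Sum>j\<le>l. monom (coeff f i * (\<sigma> ^^ i) (coeff g j)) (i + j))"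
    using assms(2) by (intro sum.mono_neutral_left) (auto simp: coeff_eq_0)
  finally show ?thesis .
qed

lemma skew_times_monom:
  assumes "\<sigma> 0 = 0"
  shows "skew_times \<sigma> (monom a i) (monom b l) = monom (a * (\<sigma> ^^ i) b) (i + l)"
proof -
  have [simp]: "(\<sigma> ^^ k) 0 = 0" for k by (induction k) (simp_all add: assms)
  have "skew_times \<sigma> (monom a i) (monom b l) =
      (\<Sum>i'\<le>i. \<Sum>l'\<le>l. if l' = l then if i' = i then monom (a * (\<sigma> ^^ i) b) (i + l) else 0 else 0)"
    unfolding skew_times_eq_sum[where \<sigma> = \<sigma> and k = i and l = l, OF assms degree_monom_le degree_monom_le]
    by (intro sum.cong refl) simp
  also have "\<dots> = monom (a * (\<sigma> ^^ i) b) (i + l)"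
    by simp
  finally show ?thesis .
qed

lemma degree_skew_times_le: "degree (skew_times \<sigma> f g) \<le> degree f + degree g"
  unfolding skew_times_def
  by (intro degree_sum_le finite_atMost order.trans[OF degree_monom_le]) auto

text \<open>Only the two leading terms meet in this exponent. Their product may vanish when the
  coefficient ring has zero divisors.\<close>

lemma coeff_skew_times_degree_add:
  "coeff (skew_times \<sigma> f g) (degree f + degree g) =
     lead_coeff f * (\<sigma> ^^ degree f) (lead_coeff g)"
proof -
  have "coeff (skew_times \<sigma> f g) (degree f + degree g) =
      (\<Sum>i\<le>degree f. \<Sum>j\<le>degree g. if j = degree g then
        if i = degree f then lead_coeff f * (\<sigma> ^^ degree f) (lead_coeff g) else 0 else 0)"
    unfolding skew_times_def coeff_sum by (intro sum.cong) auto
  then show ?thesis by simp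
qed

locale central_quotient =
  fixes \<sigma> :: "'a::ring_1 \<Rightarrow> 'a" and \<iota> :: "'f::field \<Rightarrow> 'a" and u :: 'a and n :: nat
    and j :: "'a poly \<Rightarrow> 'b::ring_1" and s :: "'f poly fract \<Rightarrow> 'b"
  assumes \<sigma>_automorphism: "ring_automorphism \<sigma>"
    and n_pos: "n > 0"
    and \<iota>_hom: "Ring_Hom.ring_hom \<iota>"
    and \<iota>_commute: "\<iota> c * z = z * \<iota> c"
    and \<sigma>_\<iota>: "\<sigma> (\<iota> c) = \<iota> c"
    and unit_u: "ring_unit u"
    and \<sigma>_pow_n: "(\<sigma> ^^ n) z = u * z * ring_inv u"
    and \<sigma>_u: "\<sigma> u = u"
    and quotient_ring: "is_central_quotient_ring \<sigma> \<iota> u n j s"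
begin

sublocale \<sigma>: Ring_Hom.ring_hom \<sigma>
  using \<sigma>_automorphism by (simp add: ring_automorphism_def)

sublocale \<iota>: Ring_Hom.ring_hom \<iota> by (fact \<iota>_hom)

sublocale s: Ring_Hom.ring_hom s
  using quotient_ring by (simp add: is_central_quotient_ring_def)

abbreviation v where "v \<equiv> ring_inv u"
abbreviation ce where "ce \<equiv> central_eval \<sigma> \<iota> u n"
abbreviation S where "S p \<equiv> s (to_fract p)"

section \<open>The unit \<open>u\<close>, its inverse, and the powers of
  \<open>\<sigma>\<close>\<close>

lemma u_v: "u * v = 1" and v_u: "v * u = 1"
proof -
  obtain w where w: "u * w = 1" "w * u = 1" using unit_u by (auto simp: ring_unit_def)
  have "u * v = 1 \<and> v * u = 1"
    unfolding ring_inv_def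
  proof (rule theI)
    show "u * w = 1 \<and> w * u = 1" using w by simp
    show "w' = w" if "u * w' = 1 \<and> w' * u = 1" for w'
      using that w by (metis mult.assoc mult.left_neutral mult.right_neutral)
  qed
  then show "u * v = 1" "v * u = 1" by auto
qed

lemma u_pow_v_pow: "u ^ k * v ^ k = 1" and v_pow_u_pow: "v ^ k * u ^ k = 1"
proof (induction k)
  case (Suc k)
  { case 1
    have "u ^ Suc k * v ^ Suc k = u ^ k * (u * v) * v ^ k"
      by (simp only: power_Suc2[of u] power_Suc[of v] mult.assoc)
    then show ?case using Suc u_v by simp }
  { case 2
    have "v ^ Suc k * u ^ Suc k = v ^ k * (v * u) * u ^ k"
      by (simp only: power_Suc2[of v] power_Suc[of u] mult.assoc)
    then show ?case using Suc v_u by simp }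
qed simp_all

lemma \<sigma>_v: "\<sigma> v = v"
proof -
  have "\<sigma> v = \<sigma> v * (u * v)" using u_v by simp
  also have "\<dots> = \<sigma> (v * u) * v" by (simp add: \<sigma>.hom_mult \<sigma>_u mult.assoc)
  finally show ?thesis using v_u by simp
qed

lemma \<sigma>_pow_0 [simp]: "(\<sigma> ^^ k) 0 = 0" by (induction k) simp_all

lemma \<sigma>_pow_mult: "(\<sigma> ^^ k) (x * y) = (\<sigma> ^^ k) x * (\<sigma> ^^ k) y"
  by (induction k) (simp_all add: \<sigma>.hom_mult)

lemma \<sigma>_pow_v_pow: "(\<sigma> ^^ k) (v ^ l) = v ^ l"
  by (induction k) (simp_all add: \<sigma>.hom_power \<sigma>_v)

lemma \<sigma>_pow_\<iota>: "(\<sigma> ^^ k) (\<iota> c) = \<iota> c"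
  by (induction k) (simp_all add: \<sigma>_\<iota>)

lemma \<sigma>_pow_n_mult: "(\<sigma> ^^ (n * k)) z = u ^ k * z * v ^ k"
proof (induction k)
  case (Suc k)
  have "(\<sigma> ^^ (n * Suc k)) z = (\<sigma> ^^ n) ((\<sigma> ^^ (n * k)) z)" by (simp add: funpow_add)
  also have "\<dots> = u ^ Suc k * z * v ^ Suc k"
    by (simp add: Suc \<sigma>_pow_n mult.assoc power_commutes)
  finally show ?case .
qed simp

section \<open>The embedding of R and the central polynomials in x\<close>

lemma j_add: "j (f + g) = j f + j g"
  and j_times: "j (skew_times \<sigma> f g) = j f * j g"
  and j_1: "j [:1:] = 1"
  and j_inj: "inj j"
  and S_eq: "S p = j (ce p)"
  using quotient_ring by (auto simp: is_central_quotient_ring_def)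

lemma j_eq_iff: "j f = j g \<longleftrightarrow> f = g" using j_inj by (auto simp: inj_eq)

lemma j_0: "j 0 = 0" using j_add[of 0 0] by simp

lemma j_diff: "j (f - g) = j f - j g" using j_add[of "f - g" g] by simp

lemma j_sum: "j (sum f I) = (\<Sum>i\<in>I. j (f i))"
  by (induction I rule: infinite_finite_induct) (simp_all add: j_0 j_add)

lemma j_monom_times: "j (monom a i) * j (monom b l) = j (monom (a * (\<sigma> ^^ i) b) (i + l))"
  by (simp add: skew_times_monom flip: j_times)

lemma j_eq_sum_monom: "j f = (\<Sum>i\<le>degree f. j (monom (coeff f i) i))"
  by (subst (1) poly_as_sum_of_monoms[symmetric]) (rule j_sum)

text \<open>Because \<open>\<sigma>\<close> fixes \<open>v\<close>, the power x^k is the single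
  monomial v^k t^(nk).\<close>

lemma ce_eq_sum: "ce p = (\<Sum>k\<le>degree p. monom (\<iota> (coeff p k) * v ^ k) (n * k))"
proof -
  have "skew_power \<sigma> (monom v n) k = monom (v ^ k) (n * k)" for k
    by (induction k) (simp_all add: skew_power_def skew_times_monom \<sigma>_pow_v_pow monom_0)
  then show ?thesis
    unfolding central_eval_def monom_0[symmetric] by (simp add: skew_times_monom)
qed

lemma coeff_ce: "coeff (ce p) (n * k) = \<iota> (coeff p k) * v ^ k"
proof -
  have "coeff (ce p) (n * k) = (\<Sum>l\<le>degree p. if l = k then \<iota> (coeff p k) * v ^ k else 0)"
    unfolding ce_eq_sum coeff_sum using n_pos by (intro sum.cong) auto
  then show ?thesis by (auto simp: coeff_eq_0)
qed

lemma \<iota>_eq_0_iff: "\<iota> c = 0 \<longleftrightarrow> c = 0"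
proof
  assume "\<iota> c = 0"
  show "c = 0"
  proof (rule ccontr)
    assume "c \<noteq> 0"
    then have "1 = \<iota> (c * inverse c)" by simp
    also have "\<dots> = 0" using \<open>\<iota> c = 0\<close> by (simp add: \<iota>.hom_mult)
    finally show False by simp
  qed
qed simp

lemma degree_ce: "degree (ce p) = n * degree p"
proof (cases "p = 0")
  case True
  then show ?thesis by (simp add: ce_eq_sum)
next
  case False
  have "degree (ce p) \<le> n * degree p"
    unfolding ce_eq_sum by (intro degree_sum_le) (auto intro: order.trans[OF degree_monom_le])
  moreover have "coeff (ce p) (n * degree p) \<noteq> 0"
  proof
    assume "coeff (ce p) (n * degree p) = 0"
    then have "\<iota> (lead_coeff p) * (v ^ degree p * u ^ degree p) = 0"
      unfolding coeff_ce by (simp flip: mult.assoc)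
    then show False using False by (simp add: v_pow_u_pow \<iota>_eq_0_iff)
  qed
  ultimately show ?thesis by (simp add: le_antisym le_degree)
qed

text \<open>Moving t^(nk) past \<open>a\<close> replaces \<open>a\<close> by u^k a v^k. The factor
  v^k of x^k cancels u^k on the left, so one v^k remains on the right of \<open>a\<close>.\<close>

lemma ce_times_monom:
  "S p * j (monom a r) = (\<Sum>k\<le>degree p. j (monom (\<iota> (coeff p k) * a * v ^ k) (n * k + r)))"
proof -
  have "\<iota> c * v ^ k * (u ^ k * a * v ^ k) = \<iota> c * a * v ^ k" for c k
    using v_pow_u_pow[of k] by (metis mult.assoc mult.left_neutral)
  then show ?thesis
    unfolding S_eq ce_eq_sum j_sum by (simp add: sum_distrib_right j_monom_times \<sigma>_pow_n_mult)
qed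

text \<open>It suffices to treat monomials. As \<open>\<sigma>\<close> fixes \<open>v\<close> and
  the image of \<open>\<iota>\<close>, multiplication by \<open>S p\<close> from the right gives the
  same sum as in \<open>ce_times_monom\<close>.\<close>

lemma S_commute: "S p * j f = j f * S p"
proof -
  have *: "S p * j (monom a r) = j (monom a r) * S p" for a r
  proof -
    have "a * (\<iota> c * v ^ k) = \<iota> c * a * v ^ k" for c k
      by (metis \<iota>_commute mult.assoc)
    then have "j (monom a r) * S p = (\<Sum>k\<le>degree p. j (monom (\<iota> (coeff p k) * a * v ^ k) (n * k + r)))"
      unfolding S_eq ce_eq_sum j_sum
      by (simp add: sum_distrib_left j_monom_times \<sigma>_pow_mult \<sigma>_pow_v_pow \<sigma>_pow_\<iota> add.commute)
    then show ?thesis by (simp add: ce_times_monom)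
  qed
  show ?thesis
    by (subst (1 2) j_eq_sum_monom) (simp add: sum_distrib_left sum_distrib_right *)
qed

lemma S_const: "S [:c:] = j [:\<iota> c:]"
  unfolding S_eq ce_eq_sum by (simp add: monom_0)

lemma right_divides_iff: "right_divides \<sigma> g f \<longleftrightarrow> (\<exists>q. j f = j q * j g)"
  by (simp add: right_divides_def j_eq_iff flip: j_times)

end

section \<open>Splitting fields\<close>

locale split_central_quotient = central_quotient \<sigma> \<iota> u n j s
  for \<sigma> :: "'a::ring_1 \<Rightarrow> 'a" and \<iota> :: "'f::field \<Rightarrow> 'a" and u :: 'a and n :: nat
    and j :: "'a poly \<Rightarrow> 'b::ring_1" and s :: "'f poly fract \<Rightarrow> 'b" +
  fixes k :: nat and i :: "'f poly fract \<Rightarrow> 'k::field" and \<phi> :: "'b \<Rightarrow> 'k mat"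
    and N :: "'b \<Rightarrow> 'f poly fract"
  assumes splitting: "is_splitting s k i \<phi>"
    and norm: "i (N y) = det (\<phi> y)"
begin

sublocale i: field_hom i using splitting by (simp add: is_splitting_def)

lemma \<phi>_carrier [simp]: "\<phi> y \<in> carrier_mat k k"
  and \<phi>_1: "\<phi> 1 = 1\<^sub>m k"
  and \<phi>_add: "\<phi> (y + y') = \<phi> y + \<phi> y'"
  and \<phi>_mult: "\<phi> (y * y') = \<phi> y * \<phi> y'"
  and \<phi>_s: "\<phi> (s z) = i z \<cdot>\<^sub>m 1\<^sub>m k"
  using splitting by (auto simp: is_splitting_def)

lemma \<phi>_dim [simp]: "dim_row (\<phi> y) = k" "dim_col (\<phi> y) = k"
  by (rule carrier_matD[OF \<phi>_carrier])+

lemma \<phi>_sum_index: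
  assumes "p < k" "q < k"
  shows "\<phi> (\<Sum>l\<in>I. s (z l) * y l) $$ (p, q) = (\<Sum>l\<in>I. i (z l) * \<phi> (y l) $$ (p, q))"
proof (induction I rule: infinite_finite_induct)
  case (insert l I)
  have "\<phi> (s (z l) * y l) = i (z l) \<cdot>\<^sub>m \<phi> (y l)"
    unfolding \<phi>_mult \<phi>_s by (subst mult_smult_assoc_mat[of _ k k _ k]) auto
  then show ?case using insert assms by (simp add: \<phi>_add)
qed (use assms \<phi>_s[of 0] in auto)

lemma N_mult: "N (x * y) = N x * N y"
proof -
  have "i (N (x * y)) = i (N x * N y)"
    unfolding norm \<phi>_mult by (simp add: det_mult[of _ k] norm hom_distribs)
  then show ?thesis by (simp only: i.eq_iff)
qed

lemma N_s: "N (s z) = z ^ k"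
proof -
  have "i (N (s z)) = i (z ^ k)"
    unfolding norm \<phi>_s by (simp add: det_smult hom_distribs)
  then show ?thesis by (simp only: i.eq_iff)
qed

lemma N_1: "N 1 = 1" using N_s[of 1] by simp

lemma N_power: "N (y ^ q) = N y ^ q"
  by (induction q) (simp_all add: N_1 N_mult)

text \<open>The coordinates of \<open>y\<close> over F(x) are fixed linear forms in the entries of
  \<open>\<phi> y\<close>: \<open>c p q\<close> holds the coordinates of a matrix unit in the basis
  of the \<open>\<phi> (b l)\<close>, and expansions in that basis are unique. Bounds on entries
  thereby become bounds on coordinates.\<close>

lemma central_basis:
  obtains b c where "\<And>y. \<exists>z. y = (\<Sum>l<k\<^sup>2. s (z l) * b l) \<and>
    (\<forall>l<k\<^sup>2. i (z l) = (\<Sum>(p, q)\<in>{..<k} \<times> {..<k}. c p q l * \<phi> y $$ (p, q)))"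
proof -
  from splitting obtain b where "left_basis (range s) UNIV (k ^ 2) b \<and>
        (\<forall>M\<in>carrier_mat k k. \<exists>!c. (\<forall>l\<ge>k ^ 2. c l = 0) \<and>
           (\<forall>p<k. \<forall>q<k. M $$ (p, q) = (\<Sum>l<k ^ 2. c l * \<phi> (b l) $$ (p, q))))"
    unfolding is_splitting_def by (elim conjE exE) (rule that, intro conjI)
  then have b: "left_basis (range s) UNIV (k ^ 2) b"
    and uniq: "\<And>M. M \<in> carrier_mat k k \<Longrightarrow> \<exists>!c. (\<forall>l\<ge>k ^ 2. c l = 0) \<and>
           (\<forall>p<k. \<forall>q<k. M $$ (p, q) = (\<Sum>l<k ^ 2. c l * \<phi> (b l) $$ (p, q)))"
    by simp_all
  \<comment> \<open>The matrix unit at position (p, q).\<close>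
  let ?E = "\<lambda>p q. mat k k (\<lambda>pq. if pq = (p, q) then 1 else 0)"
  define R where "R p q c \<longleftrightarrow> (\<forall>l\<ge>k ^ 2. c l = 0) \<and>
      (\<forall>p'<k. \<forall>q'<k. ?E p q $$ (p', q') = (\<Sum>l<k ^ 2. c l * \<phi> (b l) $$ (p', q')))" for p q c
  have "\<exists>c. R p q c" for p q
    unfolding R_def by (rule ex1_implies_ex, rule uniq) simp
  then obtain c where R: "\<And>p q. R p q (c p q)" by metis
  have c0: "c p q l = 0" if "l \<ge> k ^ 2" for p q l
    using R[of p q] that unfolding R_def by blast
  have c: "?E p q $$ (p', q') = (\<Sum>l<k ^ 2. c p q l * \<phi> (b l) $$ (p', q'))" if "p' < k" "q' < k" for p q p' q'
    using R[of p q] that unfolding R_def by blast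
  have "\<exists>z. y = (\<Sum>l<k\<^sup>2. s (z l) * b l) \<and>
    (\<forall>l<k\<^sup>2. i (z l) = (\<Sum>(p, q)\<in>{..<k} \<times> {..<k}. c p q l * \<phi> y $$ (p, q)))" for y
  proof -
    obtain x where x: "\<forall>l<k\<^sup>2. x l \<in> range s" "y = (\<Sum>l<k\<^sup>2. x l * b l)"
      using b[unfolded left_basis_def, THEN conjunct2, THEN bspec, OF UNIV_I, of y]
      by (elim ex1E conjE) (rule that)
    define z where "z l = inv_into UNIV s (x l)" for l
    have z: "x l = s (z l)" if "l < k\<^sup>2" for l
      using x(1) that by (simp add: z_def f_inv_into_f)
    have y: "y = (\<Sum>l<k\<^sup>2. s (z l) * b l)" unfolding x(2) using z by (intro sum.cong) auto
    \<comment> \<open>Uniqueness concerns coefficient functions that vanish from k^2 on, hence the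
      default value 0.\<close>
    define c1 where "c1 l = (if l < k\<^sup>2 then i (z l) else 0)" for l
    define c2 where "c2 l = (\<Sum>(p, q)\<in>{..<k} \<times> {..<k}. c p q l * \<phi> y $$ (p, q))" for l
    have 1: "\<phi> y $$ (p', q') = (\<Sum>l<k\<^sup>2. c1 l * \<phi> (b l) $$ (p', q'))" if "p' < k" "q' < k" for p' q'
      by (subst y, subst \<phi>_sum_index[OF that]) (auto simp: c1_def)
    have 2: "\<phi> y $$ (p', q') = (\<Sum>l<k\<^sup>2. c2 l * \<phi> (b l) $$ (p', q'))" if "p' < k" "q' < k" for p' q'
    proof -
      have "(\<Sum>l<k\<^sup>2. c2 l * \<phi> (b l) $$ (p', q')) =
        (\<Sum>(p, q)\<in>{..<k} \<times> {..<k}. \<phi> y $$ (p, q) * (\<Sum>l<k\<^sup>2. c p q l * \<phi> (b l) $$ (p', q')))"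
        unfolding c2_def sum_distrib_right sum_distrib_left case_prod_unfold
        by (subst sum.swap) (simp add: ac_simps)
      also have "\<dots> = (\<Sum>pq\<in>{..<k} \<times> {..<k}. if pq = (p', q') then \<phi> y $$ pq else 0)"
        using that by (intro sum.cong) (auto simp flip: c split: if_splits)
      also have "\<dots> = \<phi> y $$ (p', q')" using that by (subst sum.delta) auto
      finally show ?thesis by simp
    qed
    have "c1 l = 0 \<and> c2 l = 0" if "l \<ge> k\<^sup>2" for l
      using that by (simp add: c1_def c2_def c0 case_prod_unfold)
    then have "c1 = c2"
      using uniq[OF \<phi>_carrier[of y]] 1 2 by blast
    then have "\<forall>l<k\<^sup>2. i (z l) = c2 l" by (metis c1_def)
    then show ?thesis using y unfolding c2_def by blast
  qed
  then show ?thesis by (rule that)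
qed

lemma \<phi>_inj: assumes "\<phi> x = \<phi> y" shows "x = y"
proof -
  obtain b c where bc: "\<And>y. \<exists>z. y = (\<Sum>l<k\<^sup>2. s (z l) * b l) \<and>
    (\<forall>l<k\<^sup>2. i (z l) = (\<Sum>(p, q)\<in>{..<k} \<times> {..<k}. c p q l * \<phi> y $$ (p, q)))"
    using central_basis by blast
  obtain z where z: "x = (\<Sum>l<k\<^sup>2. s (z l) * b l)"
    "\<forall>l<k\<^sup>2. i (z l) = (\<Sum>(p, q)\<in>{..<k} \<times> {..<k}. c p q l * \<phi> x $$ (p, q))" using bc by blast
  obtain z' where z': "y = (\<Sum>l<k\<^sup>2. s (z' l) * b l)"
    "\<forall>l<k\<^sup>2. i (z' l) = (\<Sum>(p, q)\<in>{..<k} \<times> {..<k}. c p q l * \<phi> y $$ (p, q))" using bc by blast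
  have "i (z l) = i (z' l)" if "l < k\<^sup>2" for l using z(2) z'(2) assms that by simp
  then show ?thesis unfolding z(1) z'(1) by simp
qed

text \<open>One-sided inverses of square matrices over a field are two-sided, and
  \<open>\<phi>\<close> is injective.\<close>

lemma left_inverse_imp_right_inverse:
  fixes x y :: 'b
  assumes "y * x = 1" shows "x * y = 1"
proof (rule \<phi>_inj)
  have "\<phi> y * \<phi> x = 1\<^sub>m k" using assms by (metis \<phi>_1 \<phi>_mult)
  then have "\<phi> x * \<phi> y = 1\<^sub>m k" by (rule mat_mult_left_right_inverse[rotated 2]) auto
  then show "\<phi> (x * y) = \<phi> 1" by (simp add: \<phi>_1 \<phi>_mult)
qed

section \<open>Finite generation of R over F[x]\<close>

lemma independent_card_le:
  fixes t :: "'a set"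
  assumes t: "finite t"
    and indep: "\<And>c. (\<Sum>x\<in>t. \<iota> (c x) * x) = 0 \<Longrightarrow> \<forall>x\<in>t. c x = 0"
  shows "card t \<le> k\<^sup>2"
proof (rule ccontr)
  assume "\<not> card t \<le> k\<^sup>2"
  obtain b c where "\<And>y. \<exists>z. y = (\<Sum>l<k\<^sup>2. s (z l) * b l) \<and>
    (\<forall>l<k\<^sup>2. i (z l) = (\<Sum>(p, q)\<in>{..<k} \<times> {..<k}. c p q l * \<phi> y $$ (p, q)))"
    using central_basis by blast
  then have "\<exists>z. y = (\<Sum>l<k\<^sup>2. s (z l) * b l)" for y by blast
  then obtain z where z: "\<And>y. y = (\<Sum>l<k\<^sup>2. s (z y l) * b l)" by metis
  \<comment> \<open>More constants than the dimension of B over F(x) satisfy a nontrivial relation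
    over F(x).\<close>
  obtain w where w: "\<exists>x\<in>t. w x \<noteq> 0"
    "\<And>l. l < k\<^sup>2 \<Longrightarrow> (\<Sum>x\<in>t. z (j [:x:]) l * w x) = 0"
    using homogeneous_system_nontrivial_solution[of "{..<k\<^sup>2}" t "\<lambda>l x. z (j [:x:]) l"] t
      \<open>\<not> card t \<le> k\<^sup>2\<close> by auto
  \<comment> \<open>Clearing denominators turns the relation into one with polynomial coefficients
    \<open>P x\<close>, which can be compared inside R.\<close>
  obtain D where D: "D \<noteq> 0" "\<And>x. x \<in> t \<Longrightarrow> \<exists>P. to_fract D * w x = to_fract P"
    using common_denominator[OF t, of w] by blast
  obtain P where P: "\<And>x. x \<in> t \<Longrightarrow> to_fract D * w x = to_fract (P x)" using D(2) by metis
  have "(\<Sum>x\<in>t. s (w x) * j [:x:]) = (\<Sum>x\<in>t. s (w x) * (\<Sum>l<k\<^sup>2. s (z (j [:x:]) l) * b l))"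
    using z by simp
  also have "\<dots> = (\<Sum>l<k\<^sup>2. s (\<Sum>x\<in>t. z (j [:x:]) l * w x) * b l)"
    unfolding sum_distrib_left
    by (subst sum.swap) (simp add: s.hom_sum sum_distrib_right s.hom_mult mult.commute flip: mult.assoc s.hom_mult)
  also have "\<dots> = 0" using w(2) by simp
  finally have "(\<Sum>x\<in>t. s (to_fract D) * (s (w x) * j [:x:])) = 0"
    by (metis sum_distrib_left mult_zero_right)
  then have "(\<Sum>x\<in>t. S (P x) * j (monom x 0)) = 0"
    using P by (simp add: monom_0 flip: mult.assoc s.hom_mult)
  then have "j (\<Sum>x\<in>t. \<Sum>l\<le>degree (P x). monom (\<iota> (coeff (P x) l) * x * v ^ l) (n * l + 0)) = j 0"
    unfolding ce_times_monom by (simp add: j_0 j_sum)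
  then have *: "(\<Sum>x\<in>t. \<Sum>l\<le>degree (P x). monom (\<iota> (coeff (P x) l) * x * v ^ l) (n * l)) = 0"
    by (simp add: j_eq_iff)
  \<comment> \<open>The coefficient of t^(nl) is an F-linear combination of \<open>t\<close> times
    the unit \<open>v ^ l\<close>, so independence over F applies.\<close>
  have "\<forall>x\<in>t. coeff (P x) l = 0" for l
  proof (rule indep)
    have "0 = coeff (\<Sum>x\<in>t. \<Sum>l\<le>degree (P x). monom (\<iota> (coeff (P x) l) * x * v ^ l) (n * l)) (n * l)"
      unfolding * by simp
    also have "\<dots> = (\<Sum>x\<in>t. \<Sum>l'\<le>degree (P x). if l' = l then \<iota> (coeff (P x) l) * x * v ^ l else 0)"
      unfolding coeff_sum using n_pos by (intro sum.cong) auto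
    also have "\<dots> = (\<Sum>x\<in>t. \<iota> (coeff (P x) l) * x * v ^ l)"
      by (intro sum.cong) (auto simp: coeff_eq_0)
    finally have "(\<Sum>x\<in>t. \<iota> (coeff (P x) l) * x) * v ^ l * u ^ l = 0"
      by (simp add: sum_distrib_right)
    then show "(\<Sum>x\<in>t. \<iota> (coeff (P x) l) * x) = 0" by (simp add: mult.assoc v_pow_u_pow)
  qed
  then have "P x = 0" if "x \<in> t" for x using that by (auto simp: poly_eq_iff)
  then show False using w(1) P D(1) by fastforce
qed

text \<open>A basis of A over F exists by vector space theory. It stays independent over F(x) inside
  B, so it has at most k^2 elements.\<close>

lemma finite_dimensional_coefficients:
  obtains X :: "'a set" where "finite X" "\<And>a. \<exists>c. a = (\<Sum>x\<in>X. \<iota> (c x) * x)"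
proof -
  interpret V: vector_space "\<lambda>c x. \<iota> c * x"
    by unfold_locales (simp_all add: algebra_simps \<iota>.hom_add \<iota>.hom_mult)
  define X where "X = V.extend_basis {}"
  have X: "V.independent X" "V.span X = UNIV"
    unfolding X_def by (simp_all add: V.independent_extend_basis V.span_extend_basis V.independent_empty)
  have le: "card t \<le> k\<^sup>2" if "finite t" "t \<subseteq> X" for t
  proof (rule independent_card_le[OF that(1)])
    fix c assume "(\<Sum>x\<in>t. \<iota> (c x) * x) = 0"
    then show "\<forall>x\<in>t. c x = 0" using X(1) that by (auto simp: V.dependent_explicit)
  qed
  have fin: "finite X"
  proof (rule ccontr)
    assume "infinite X"
    then obtain t where "t \<subseteq> X" "finite t" "card t = Suc (k\<^sup>2)"
      using infinite_arbitrarily_large by blast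
    then show False using le by force
  qed
  show ?thesis
  proof (rule that[OF fin])
    show "\<exists>c. a = (\<Sum>x\<in>X. \<iota> (c x) * x)" for a
      using X(2) V.span_finite[OF fin] by (metis (no_types, lifting) UNIV_I imageE)
  qed
qed

text \<open>The generators are \<open>x\<close> t^r with \<open>x\<close> in an F-basis of A and r <
  n. Writing l = nq + r, a term in t^l is a combination of x^q times such generators, so only powers
  q <= deg f / n of the central variable occur.\<close>

lemma filtered_generators:
  "\<exists>(I :: ('a \<times> nat) set) r p. finite I \<and>
    (\<forall>f. j f = (\<Sum>l\<in>I. S (p f l) * j (r l))) \<and> (\<forall>f. \<forall>l\<in>I. n * degree (p f l) \<le> degree f)"
proof -
  obtain X :: "'a set" where X: "finite X" "\<And>a. \<exists>c. a = (\<Sum>x\<in>X. \<iota> (c x) * x)"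
    using finite_dimensional_coefficients by blast
  then obtain c where c: "\<And>a. a = (\<Sum>x\<in>X. \<iota> (c a x) * x)" by metis
  let ?I = "X \<times> {..<n}"
  \<comment> \<open>The power of \<open>u\<close> compensates the power of \<open>v\<close> that the
    central variable contributes.\<close>
  define C where "C f l x = c (coeff f l * u ^ (l div n)) x" for f l x
  define p where "p f = (\<lambda>(x, r). \<Sum>l\<in>{l\<in>{..degree f}. l mod n = r}. monom (C f l x) (l div n))"
    for f
  define r where "r = (\<lambda>(x::'a, l::nat). monom x l)"
  show ?thesis
  proof (rule exI[of _ ?I], rule exI[of _ r], rule exI[of _ p], intro conjI allI ballI)
    show "finite ?I" using X(1) by simp
    show "n * degree (p f l) \<le> degree f" if l: "l \<in> ?I" for f l
    proof -
      have "degree (p f l) \<le> degree f div n"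
        unfolding p_def case_prod_unfold
        by (intro degree_sum_le) (auto intro!: order.trans[OF degree_monom_le] div_le_mono)
      then show ?thesis by (metis mult_le_mono2 order.trans mult.commute div_times_less_eq_dividend)
    qed
    show "j f = (\<Sum>l\<in>?I. S (p f l) * j (r l))" for f
    proof -
      have mono: "S (monom (C f l x) (l div n)) * j (monom x (l mod n)) =
          j (monom (\<iota> (C f l x) * x * v ^ (l div n)) l)" for l x
      proof -
        have "S (monom a m) * j (monom x q) = j (monom (\<iota> a * x * v ^ m) (n * m + q))" for a m q
        proof (cases "a = 0")
          case False
          have "(\<Sum>l\<le>m. j (monom (\<iota> (coeff (monom a m) l) * x * v ^ l) (n * l + q))) =
             (\<Sum>l\<le>m. if l = m then j (monom (\<iota> a * x * v ^ m) (n * m + q)) else 0)"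
            by (intro sum.cong) (auto simp: j_0)
          then show ?thesis unfolding ce_times_monom using False by (simp add: degree_monom_eq)
        qed (simp add: j_0)
        then show ?thesis by simp
      qed
      have "(\<Sum>l\<in>?I. S (p f l) * j (r l)) = (\<Sum>x\<in>X. \<Sum>q<n. \<Sum>l\<in>{l\<in>{..degree f}. l mod n = q}.
          S (monom (C f l x) (l div n)) * j (monom x q))"
        unfolding sum.cartesian_product p_def r_def
        by (simp add: case_prod_unfold s.hom_sum sum_distrib_right)
      also have "\<dots> = (\<Sum>x\<in>X. \<Sum>q<n. \<Sum>l\<in>{l\<in>{..degree f}. l mod n = q}.
          j (monom (\<iota> (C f l x) * x * v ^ (l div n)) l))"
        by (intro sum.cong refl) (auto simp flip: mono)
      also have "\<dots> = (\<Sum>x\<in>X. \<Sum>l\<le>degree f. j (monom (\<iota> (C f l x) * x * v ^ (l div n)) l))"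
        using n_pos by (intro sum.cong refl sum.group) auto
      also have "\<dots> = (\<Sum>l\<le>degree f. j (\<Sum>x\<in>X. monom (\<iota> (C f l x) * x * v ^ (l div n)) l))"
        by (subst sum.swap) (simp add: j_sum)
      also have "\<dots> = (\<Sum>l\<le>degree f. j (monom (coeff f l) l))"
      proof (intro sum.cong refl arg_cong[where f = j])
        fix l
        have "(\<Sum>x\<in>X. monom (\<iota> (C f l x) * x * v ^ (l div n)) l) =
          monom ((\<Sum>x\<in>X. \<iota> (C f l x) * x) * v ^ (l div n)) l"
          by (simp add: poly_eq_iff coeff_sum sum_distrib_right)
        also have "(\<Sum>x\<in>X. \<iota> (C f l x) * x) = coeff f l * u ^ (l div n)"
          unfolding C_def by (rule c[symmetric])
        finally show "(\<Sum>x\<in>X. monom (\<iota> (C f l x) * x * v ^ (l div n)) l) = monom (coeff f l) l"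
          by (simp add: mult.assoc u_pow_v_pow)
      qed
      finally show ?thesis by (simp add: j_eq_sum_monom[of f])
    qed
  qed
qed

end

section \<open>Integrality and degree of the reduced norm\<close>

context split_central_quotient
begin

text \<open>A linear projection of the splitting field onto F(x), where denominators and degrees
  make sense.\<close>

definition \<rho> where
  "\<rho> = (SOME \<rho>. (\<forall>x y. \<rho> (x + y) = \<rho> x + \<rho> y) \<and> (\<forall>z x. \<rho> (i z * x) = z * \<rho> x) \<and> \<rho> 1 = 1)"

lemma \<rho>_add: "\<rho> (x + y) = \<rho> x + \<rho> y"
  and \<rho>_scale: "\<rho> (i z * x) = z * \<rho> x"
  and \<rho>_i: "\<rho> (i z) = z"
proof -
  have "\<exists>\<rho>. (\<forall>x y. \<rho> (x + y) = \<rho> x + \<rho> y) \<and> (\<forall>z x. \<rho> (i z * x) = z * \<rho> x) \<and> \<rho> 1 = 1"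
    by (rule exists_linear_retraction[OF i.field_hom_axioms]) blast
  from someI_ex[OF this] have "(\<forall>x y. \<rho> (x + y) = \<rho> x + \<rho> y) \<and> (\<forall>z x. \<rho> (i z * x) = z * \<rho> x) \<and> \<rho> 1 = 1"
    unfolding \<rho>_def .
  then have *: "\<rho> (x + y) = \<rho> x + \<rho> y" "\<rho> (i z * x) = z * \<rho> x" "\<rho> 1 = 1" for x y z by auto
  show "\<rho> (x + y) = \<rho> x + \<rho> y" "\<rho> (i z * x) = z * \<rho> x" by (fact *)+
  show "\<rho> (i z) = z" using *(2)[of z 1] *(3) by simp
qed

lemma \<rho>_0: "\<rho> 0 = 0" using \<rho>_i[of 0] by simp

text \<open>Tame functions have denominators that do not depend on the argument and numerators whose
  degree grows at the rate of a form of degree \<open>m\<close>. The factor \<open>c\<close> makes the class closed under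
  multiplication by constants from the splitting field, although \<open>\<rho>\<close> is linear only over \<open>F(x)\<close>.\<close>

definition tame :: "nat \<Rightarrow> ('a poly \<Rightarrow> 'k) \<Rightarrow> bool" where
  "tame m h \<longleftrightarrow> (\<forall>c. \<exists>D b. D \<noteq> 0 \<and>
     (\<forall>g. \<exists>W. to_fract D * \<rho> (c * h g) = to_fract W \<and> n * degree W \<le> m * degree g + b))"

lemma tame_0: "tame m (\<lambda>_. 0)"
  unfolding tame_def by (intro allI exI[of _ 1] exI[of _ 0] conjI exI[of _ 0]) (auto simp: \<rho>_0)

lemma tame_add:
  assumes "tame m h" "tame m h'"
  shows "tame m (\<lambda>g. h g + h' g)"
  unfolding tame_def
proof
  fix c
  obtain D b where D: "D \<noteq> 0" "\<And>g. \<exists>W. to_fract D * \<rho> (c * h g) = to_fract W \<and> n * degree W \<le> m * degree g + b"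
    using assms(1) unfolding tame_def by meson
  obtain D' b' where D': "D' \<noteq> 0" "\<And>g. \<exists>W. to_fract D' * \<rho> (c * h' g) = to_fract W \<and> n * degree W \<le> m * degree g + b'"
    using assms(2) unfolding tame_def by meson
  show "\<exists>D b. D \<noteq> 0 \<and> (\<forall>g. \<exists>W. to_fract D * \<rho> (c * (h g + h' g)) = to_fract W \<and> n * degree W \<le> m * degree g + b)"
  \<comment> \<open>Cross-multiplication puts the other denominator into each numerator, which adds
    its degree to the constant.\<close>
  proof (rule exI[of _ "D * D'"], rule exI[of _ "n * degree D + n * degree D' + b + b'"], intro conjI allI)
    show "D * D' \<noteq> 0" using D(1) D'(1) by simp
    fix g
    obtain W where W: "to_fract D * \<rho> (c * h g) = to_fract W" "n * degree W \<le> m * degree g + b"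
      using D(2) by blast
    obtain W' where W': "to_fract D' * \<rho> (c * h' g) = to_fract W'" "n * degree W' \<le> m * degree g + b'"
      using D'(2) by blast
    have eq: "to_fract (D * D') * \<rho> (c * (h g + h' g)) = to_fract (D' * W + D * W')"
      by (simp add: ring_distribs \<rho>_add flip: W(1) W'(1))
    have "degree (D' * W + D * W') \<le> max (degree D' + degree W) (degree D + degree W')"
      by (intro degree_add_le_max[THEN order.trans] max.mono degree_mult_le)
    then have "n * degree (D' * W + D * W') \<le> max (n * degree D' + n * degree W) (n * degree D + n * degree W')"
      by (metis (no_types, lifting) mult_le_mono2 nat_mult_max_right distrib_left)
    also have "\<dots> \<le> m * degree g + (n * degree D + n * degree D' + b + b')"
      using W(2) W'(2) by simp
    finally show "\<exists>W. to_fract (D * D') * \<rho> (c * (h g + h' g)) = to_fract W \<and>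
        n * degree W \<le> m * degree g + (n * degree D + n * degree D' + b + b')"
      using eq by blast
  qed
qed

lemma tame_sum:
  assumes "\<And>x. x \<in> X \<Longrightarrow> tame m (h x)"
  shows "tame m (\<lambda>g. \<Sum>x\<in>X. h x g)"
  using assms by (induction X rule: infinite_finite_induct) (auto intro: tame_0 tame_add)

lemma tame_cmult:
  assumes "tame m h"
  shows "tame m (\<lambda>g. a * h g)"
  using assms unfolding tame_def by (metis mult.assoc)

text \<open>The factor from F(x) passes through \<open>\<rho>\<close> and leaves the rational
  function \<open>\<rho> (c * \<kappa>)\<close>, whose denominator does not depend on
  \<open>g\<close>.\<close>

lemma tame_term:
  assumes P: "\<And>g. n * degree (P g) \<le> m * degree g"
  shows "tame m (\<lambda>g. i (to_fract (P g)) * \<kappa>)"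
  unfolding tame_def
proof
  fix c
  obtain Q D where QD: "D \<noteq> 0" "\<rho> (c * \<kappa>) = to_fract Q / to_fract D"
    by (rule fract_eq_to_fract_divide)
  show "\<exists>D b. D \<noteq> 0 \<and> (\<forall>g. \<exists>W. to_fract D * \<rho> (c * (i (to_fract (P g)) * \<kappa>)) = to_fract W \<and>
      n * degree W \<le> m * degree g + b)"
  proof (intro exI conjI allI)
    show "D \<noteq> 0" by fact
    fix g
    have "\<rho> (c * (i (to_fract (P g)) * \<kappa>)) = to_fract (P g) * \<rho> (c * \<kappa>)"
      using \<rho>_scale[of "to_fract (P g)" "c * \<kappa>"] by (simp add: ac_simps)
    then show "to_fract D * \<rho> (c * (i (to_fract (P g)) * \<kappa>)) = to_fract (P g * Q)"
      using QD by simp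
    have "n * degree (P g * Q) \<le> n * (degree (P g) + degree Q)"
      by (intro mult_le_mono2 degree_mult_le)
    also have "\<dots> \<le> m * degree g + n * degree Q" using P[of g] by (simp add: distrib_left)
    finally show "n * degree (P g * Q) \<le> m * degree g + n * degree Q" .
  qed
qed

text \<open>Row expansion over the generators writes the minor as a finite sum of fixed minors
  \<open>\<kappa> \<alpha>\<close>, each weighted by a product of \<open>m\<close> coordinates of
  degree at most deg g / n. Arbitrary selections \<open>R\<close> and \<open>C\<close> cover the
  determinant and the cofactors alike.\<close>

lemma tame_minor:
  assumes RC: "\<And>a. a < m \<Longrightarrow> R a < k" "\<And>a. a < m \<Longrightarrow> C a < k"
  shows "tame m (\<lambda>g. det (mat m m (\<lambda>(a, c). \<phi> (j g) $$ (R a, C c))))"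
proof -
  from filtered_generators obtain I :: "('a \<times> nat) set" and r p where "finite I \<and>
    (\<forall>f. j f = (\<Sum>l\<in>I. S (p f l) * j (r l))) \<and> (\<forall>f. \<forall>l\<in>I. n * degree (p f l) \<le> degree f)"
    by (elim exE) (rule that)
  then have I: "finite I" "\<And>f. j f = (\<Sum>l\<in>I. S (p f l) * j (r l))"
    "\<And>f l. l \<in> I \<Longrightarrow> n * degree (p f l) \<le> degree f" by blast+
  define \<kappa> where "\<kappa> \<alpha> = det (mat m m (\<lambda>(a, c). \<phi> (j (r (\<alpha> a))) $$ (R a, C c)))" for \<alpha>
  have "det (mat m m (\<lambda>(a, c). \<phi> (j g) $$ (R a, C c))) =
    (\<Sum>\<alpha>\<in>{0..<m} \<rightarrow>\<^sub>E I. i (to_fract (\<Prod>a=0..<m. p g (\<alpha> a))) * \<kappa> \<alpha>)" for g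
  proof -
    have prod: "to_fract (\<Prod>a\<in>A. q a) = (\<Prod>a\<in>A. to_fract (q a))" for A :: "nat set" and q :: "nat \<Rightarrow> 'f poly"
      by (induction A rule: infinite_finite_induct) auto
    have "mat m m (\<lambda>(a, c). \<phi> (j g) $$ (R a, C c)) =
        mat m m (\<lambda>(a, c). \<Sum>l\<in>I. i (to_fract (p g l)) * \<phi> (j (r l)) $$ (R a, C c))"
      by (rule cong_mat) (auto simp: I(2)[of g] \<phi>_sum_index RC)
    then show ?thesis
      using det_linear_combination[OF I(1), of m "\<lambda>l. i (to_fract (p g l))" "\<lambda>l a c. \<phi> (j (r l)) $$ (R a, C c)"]
      by (simp add: \<kappa>_def prod i.hom_prod)
  qed
  moreover have "tame m (\<lambda>g. \<Sum>\<alpha>\<in>{0..<m} \<rightarrow>\<^sub>E I. i (to_fract (\<Prod>a=0..<m. p g (\<alpha> a))) * \<kappa> \<alpha>)"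
  proof (intro tame_sum tame_term)
    fix \<alpha> g assume \<alpha>: "\<alpha> \<in> {0..<m} \<rightarrow>\<^sub>E I"
    have "n * degree (\<Prod>a=0..<m. p g (\<alpha> a)) \<le> n * (\<Sum>a=0..<m. degree (p g (\<alpha> a)))"
      by (intro mult_le_mono2 order.trans[OF degree_prod_sum_le]) auto
    also have "\<dots> \<le> (\<Sum>a=0..<m. degree g)"
      unfolding sum_distrib_left using \<alpha> by (intro sum_mono I(3)) auto
    finally show "n * degree (\<Prod>a=0..<m. p g (\<alpha> a)) \<le> m * degree g" by simp
  qed
  ultimately show ?thesis by presburger
qed

section \<open>Integrality and degree bound of the norm\<close>

lemma j_power:
  obtains g where "j g = j f ^ q" "degree g \<le> q * degree f"
proof -
  have "\<exists>g. j g = j f ^ q \<and> degree g \<le> q * degree f"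
  proof (induction q)
    case 0
    show ?case by (intro exI[of _ "[:1:]"]) (simp add: j_1)
  next
    case (Suc q)
    then obtain g where "j g = j f ^ q" "degree g \<le> q * degree f" by blast
    then show ?case using degree_skew_times_le[of \<sigma> f g]
      by (intro exI[of _ "skew_times \<sigma> f g"]) (simp add: j_times)
  qed
  then show ?thesis using that by blast
qed

lemma norm_polynomial:
  obtains p where "N (j f) = to_fract p" "n * degree p \<le> k * degree f"
proof -
  have "tame k (\<lambda>g. det (mat k k (\<lambda>(a, c). \<phi> (j g) $$ (a, c))))"
    by (rule tame_minor) auto
  moreover have "mat k k (\<lambda>(a, c). \<phi> y $$ (a, c)) = \<phi> y" for y
    by (rule eq_matI) auto
  ultimately have "tame k (\<lambda>g. i (N (j g)))" by (simp add: norm)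
  then obtain D b where D: "D \<noteq> 0" "\<And>g. \<exists>W. to_fract D * \<rho> (1 * i (N (j g))) = to_fract W \<and>
      n * degree W \<le> k * degree g + b"
    unfolding tame_def by meson
  \<comment> \<open>As \<open>N\<close> is multiplicative, applying tameness to f^q bounds
    \<open>N (j f) ^ q\<close> with \<open>D\<close> and \<open>b\<close> independent of
    \<open>q\<close>.\<close>
  have D2: "\<exists>W. to_fract D * N (j f) ^ q = to_fract W \<and> n * degree W \<le> k * (q * degree f) + b" for q
  proof -
    obtain g where g: "j g = j f ^ q" "degree g \<le> q * degree f" by (rule j_power)
    obtain W where W: "to_fract D * \<rho> (1 * i (N (j g))) = to_fract W" "n * degree W \<le> k * degree g + b"
      using D(2) by blast
    have "to_fract D * N (j f) ^ q = to_fract W" using W(1) by (simp add: \<rho>_i g(1) N_power)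
    moreover have "n * degree W \<le> k * (q * degree f) + b"
      using W(2) g(2) by (meson add_le_mono1 mult_le_mono2 order.trans)
    ultimately show ?thesis by blast
  qed
  obtain p where p: "N (j f) = to_fract p"
    using polynomial_if_powers_bounded_denominator[OF D(1), of "N (j f)"] D2 by blast
  have "n * degree p \<le> k * degree f"
  proof (cases "p = 0")
    case False
    have *: "q * (n * degree p) \<le> q * (k * degree f) + b" for q
    proof -
      obtain W where W: "to_fract D * N (j f) ^ q = to_fract W" "n * degree W \<le> k * (q * degree f) + b"
        using D2 by blast
      have "to_fract (D * p ^ q) = to_fract W" using W(1) unfolding p by (simp add: to_fract_power)
      then have "W = D * p ^ q" by (simp only: to_fract_eq_iff)
      then have "degree W = degree D + q * degree p"
        using False D(1) by (simp add: degree_mult_eq degree_power_eq)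
      then have "n * (degree D + q * degree p) \<le> q * (k * degree f) + b" using W(2) by (simp add: ac_simps)
      then show ?thesis by (simp add: algebra_simps)
    qed
    show ?thesis
    proof (rule ccontr)
      assume "\<not> ?thesis"
      then have "Suc (k * degree f) \<le> n * degree p" by simp
      \<comment> \<open>An excess of at least 1 in the degree becomes at least b + 1 for q = b + 1,
        more than the constant \<open>b\<close> allows.\<close>
      then have "Suc b * Suc (k * degree f) \<le> Suc b * (n * degree p)" by (rule mult_le_mono2)
      then show False using *[of "Suc b"] by simp
    qed
  qed simp
  with p show ?thesis by (rule that)
qed

section \<open>Elements of R whose norm is a unit\<close>

lemma tame_adjugate:
  assumes "p < k" "q < k"
  shows "tame (k - 1) (\<lambda>g. adj_mat (\<phi> (j g)) $$ (p, q))"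
proof -
  \<comment> \<open>The adjugate transposes: its entry (p, q) omits row q and column p, which the
    two index shifts skip.\<close>
  have "adj_mat (\<phi> (j g)) $$ (p, q) = (-1) ^ (q + p) * det (mat (k - 1) (k - 1) (\<lambda>(a, c).
      \<phi> (j g) $$ (if a < q then a else Suc a, if c < p then c else Suc c)))" for g
    using assms by (simp add: adj_mat_def cofactor_def mat_delete_def)
  moreover have "tame (k - 1) (\<lambda>g. (-1) ^ (q + p) * det (mat (k - 1) (k - 1) (\<lambda>(a, c).
      \<phi> (j g) $$ (if a < q then a else Suc a, if c < p then c else Suc c))))"
    by (intro tame_cmult tame_minor) auto
  ultimately show ?thesis by presburger
qed

text \<open>As N(f) is a unit of F[x], the matrix of y^q is a unit multiple of the adjugate of the
  matrix of f^q. Cofactors are tame, so their projected denominators do not depend on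
  \<open>q\<close>.\<close>

lemma inverse_powers_bounded_denominator:
  assumes y: "y * j f = 1" and c: "N (j f) = to_fract c" "c dvd 1"
  obtains D where "D \<noteq> 0" "\<And>q. S D * y ^ q \<in> range j"
proof -
  obtain c' where c': "c * c' = 1" using c(2) by (auto elim: dvdE)
  obtain b C where bC: "\<And>y. \<exists>z. y = (\<Sum>l<k\<^sup>2. s (z l) * b l) \<and>
    (\<forall>l<k\<^sup>2. i (z l) = (\<Sum>(p, q)\<in>{..<k} \<times> {..<k}. C p q l * \<phi> y $$ (p, q)))"
    using central_basis by blast
  have "\<forall>l. \<exists>gh. snd gh \<noteq> 0 \<and> b l = j (fst gh) * s (inverse (to_fract (snd gh)))"
    using quotient_ring unfolding is_central_quotient_ring_def by simp
  from choice[OF this] obtain bnd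
    where bnd: "\<forall>l. snd (bnd l) \<noteq> 0 \<and> b l = j (fst (bnd l)) * s (inverse (to_fract (snd (bnd l))))" ..
  define bn bd where "bn l = fst (bnd l)" and "bd l = snd (bnd l)" for l
  have b: "bd l \<noteq> 0" "b l = j (bn l) * s (inverse (to_fract (bd l)))" for l
    using bnd unfolding bn_def bd_def by blast+
  \<comment> \<open>\<open>E\<close> clears the denominators of all the basis elements
    \<open>b l\<close>.\<close>
  obtain E where E: "E \<noteq> 0" "\<And>l. l < k\<^sup>2 \<Longrightarrow> \<exists>P. to_fract E * inverse (to_fract (bd l)) = to_fract P"
    using common_denominator[of "{..<k\<^sup>2}" "\<lambda>l. inverse (to_fract (bd l))"] by auto
  have Eb: "\<exists>g. S E * b l = j g" if l: "l < k\<^sup>2" for l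
  proof -
    obtain P where P: "to_fract E * inverse (to_fract (bd l)) = to_fract P" using E(2)[OF l] by blast
    have "S E * b l = j (bn l) * (S E * s (inverse (to_fract (bd l))))"
      unfolding b(2) by (metis S_commute mult.assoc)
    also have "\<dots> = j (skew_times \<sigma> (bn l) (ce P))" unfolding j_times S_eq[symmetric] P[symmetric] s.hom_mult ..
    finally show ?thesis by blast
  qed
  \<comment> \<open>The linear form of \<open>central_basis\<close> for coordinate \<open>l\<close>,
    evaluated at the adjugate.\<close>
  define h where "h l g = (\<Sum>(p, q)\<in>{..<k} \<times> {..<k}. C p q l * adj_mat (\<phi> (j g)) $$ (p, q))" for l g
  have "tame (k - 1) (h l)" for l
    unfolding h_def by (intro tame_sum) (clarsimp, intro tame_cmult tame_adjugate[simplified])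
  then have "\<exists>D. D \<noteq> 0 \<and> (\<forall>g. \<exists>W. to_fract D * \<rho> (1 * h l g) = to_fract W)" for l
    unfolding tame_def by meson
  then obtain D where D: "\<And>l. D l \<noteq> 0" "\<And>l g. \<exists>W. to_fract (D l) * \<rho> (h l g) = to_fract W"
    by (metis mult_1)
  \<comment> \<open>\<open>DD\<close> clears the denominators of all coordinates at once.\<close>
  define DD where "DD = (\<Prod>l<k\<^sup>2. D l)"
  show ?thesis
  proof (rule that)
    show "DD * E \<noteq> 0" using D(1) E(1) by (simp add: DD_def)
    fix q
    obtain g where g: "j g = j f ^ q" "degree g \<le> q * degree f" by (rule j_power)
    have yg: "y ^ q * j g = 1"
      unfolding g(1)
    proof (induction q)
      case (Suc q)
      have "y ^ Suc q * j f ^ Suc q = y ^ q * (y * j f) * j f ^ q"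
        by (simp only: power_Suc2[of y] power_Suc[of "j f"] mult.assoc)
      then show ?case using Suc y by simp
    qed simp
    have Nc: "N (j g) * to_fract (c' ^ q) = 1"
    proof -
      have "N (j g) * to_fract (c' ^ q) = to_fract ((c * c') ^ q)"
        by (simp add: g(1) N_power c(1) to_fract_power power_mult_distrib)
      then show ?thesis by (simp add: c')
    qed
    have \<phi>y: "\<phi> (y ^ q) $$ (p, p') = i (to_fract (c' ^ q)) * adj_mat (\<phi> (j g)) $$ (p, p')"
      if "p < k" "p' < k" for p p'
    proof -
      have adj: "adj_mat (\<phi> (j g)) \<in> carrier_mat k k"
          "\<phi> (j g) * adj_mat (\<phi> (j g)) = det (\<phi> (j g)) \<cdot>\<^sub>m 1\<^sub>m k"
        using adj_mat[OF \<phi>_carrier] by auto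
      have "\<phi> (y ^ q) * \<phi> (j g) = 1\<^sub>m k" using yg by (metis \<phi>_mult \<phi>_1)
      then have "adj_mat (\<phi> (j g)) = \<phi> (y ^ q) * \<phi> (j g) * adj_mat (\<phi> (j g))"
        using adj(1) by simp
      also have "\<dots> = \<phi> (y ^ q) * (\<phi> (j g) * adj_mat (\<phi> (j g)))"
        by (rule assoc_mult_mat[OF \<phi>_carrier \<phi>_carrier adj(1)])
      also have "\<dots> = i (N (j g)) \<cdot>\<^sub>m \<phi> (y ^ q)"
        unfolding adj(2) norm[symmetric]
        by (subst mult_smult_distrib[OF \<phi>_carrier, of _ k]) auto
      finally have "adj_mat (\<phi> (j g)) $$ (p, p') = i (N (j g)) * \<phi> (y ^ q) $$ (p, p')"
        using that by simp
      moreover have "i (to_fract (c' ^ q)) * i (N (j g)) = 1"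
        using Nc by (metis i.hom_mult i.hom_one mult.commute)
      ultimately show ?thesis by (simp flip: mult.assoc)
    qed
    obtain z where z: "y ^ q = (\<Sum>l<k\<^sup>2. s (z l) * b l)"
      "\<And>l. l < k\<^sup>2 \<Longrightarrow> i (z l) = (\<Sum>(p, p')\<in>{..<k} \<times> {..<k}. C p p' l * \<phi> (y ^ q) $$ (p, p'))"
      using bC[of "y ^ q"] by blast
    have "\<exists>W. to_fract DD * z l = to_fract W" if l: "l < k\<^sup>2" for l
    proof -
      have "i (z l) = i (to_fract (c' ^ q)) * h l g"
        unfolding z(2)[OF l] h_def sum_distrib_left by (intro sum.cong) (auto simp: \<phi>y)
      \<comment> \<open>The coordinate already lies in F(x), so projecting it by
        \<open>\<rho>\<close> leaves it unchanged.\<close>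
      then have "z l = to_fract (c' ^ q) * \<rho> (h l g)" by (metis \<rho>_i \<rho>_scale)
      moreover obtain W where "to_fract (D l) * \<rho> (h l g) = to_fract W" using D(2) by blast
      moreover have "DD = D l * (\<Prod>l\<in>{..<k\<^sup>2} - {l}. D l)"
        unfolding DD_def using l by (intro prod.remove) auto
      ultimately have "to_fract DD * z l = to_fract (W * (\<Prod>l\<in>{..<k\<^sup>2} - {l}. D l) * c' ^ q)"
        by (simp add: ac_simps)
      then show ?thesis by blast
    qed
    then obtain W where W: "\<And>l. l < k\<^sup>2 \<Longrightarrow> to_fract DD * z l = to_fract (W l)" by metis
    obtain G where G: "\<And>l. l < k\<^sup>2 \<Longrightarrow> S E * b l = j (G l)" using Eb by metis
    have "S (DD * E) * y ^ q = (\<Sum>l<k\<^sup>2. s (to_fract DD * z l) * (S E * b l))"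
      unfolding z(1) sum_distrib_left mult.assoc[symmetric] s.hom_mult[symmetric] to_fract_mult
      by (simp add: ac_simps)
    also have "\<dots> = (\<Sum>l<k\<^sup>2. S (W l) * j (G l))" by (intro sum.cong) (auto simp: W G)
    also have "\<dots> = j (\<Sum>l<k\<^sup>2. skew_times \<sigma> (ce (W l)) (G l))" by (simp add: j_sum j_times S_eq)
    finally show "S (DD * E) * y ^ q \<in> range j" by simp
  qed
qed

text \<open>R is finitely generated over F[x], so modulo \<open>D\<close> it has finite dimension
  over F, and the powers of \<open>f\<close> become dependent.\<close>

lemma linear_dependence_of_powers:
  assumes "D \<noteq> 0"
  obtains c M w where "\<exists>q\<le>M. c q \<noteq> 0" "(\<Sum>q\<le>M. S [:c q:] * j f ^ q) = S D * j w"
proof -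
  from filtered_generators obtain I :: "('a \<times> nat) set" and r p where "finite I \<and>
    (\<forall>f. j f = (\<Sum>l\<in>I. S (p f l) * j (r l))) \<and> (\<forall>f. \<forall>l\<in>I. n * degree (p f l) \<le> degree f)"
    by (elim exE) (rule that)
  then have I: "finite I" "\<And>f. j f = (\<Sum>l\<in>I. S (p f l) * j (r l))" by blast+
  have "\<exists>g. j f ^ q = j g" for q by (rule j_power[of f q]) metis
  then obtain g where g: "\<And>q. j f ^ q = j (g q)" by metis
  define P where "P q l = p (g q) l" for q l
  have gP: "j f ^ q = (\<Sum>l\<in>I. S (P q l) * j (r l))" for q
    unfolding g P_def by (rule I(2))
  \<comment> \<open>A pair names a generator and one coefficient of a remainder modulo
    \<open>D\<close>. The powers 0, ..., \<open>M\<close> with \<open>M = card I'\<close> outnumber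
    these equations by one.\<close>
  define I' where "I' = I \<times> {..<degree D}"
  have finI': "finite I'" using I(1) by (simp add: I'_def)
  define M where "M = card I'"
  obtain c where c: "\<exists>q\<in>{..M}. c q \<noteq> 0"
    "\<And>lt. lt \<in> I' \<Longrightarrow> (\<Sum>q\<le>M. coeff (P q (fst lt) mod D) (snd lt) * c q) = 0"
    using homogeneous_system_nontrivial_solution[OF finI', of "{..M}"
        "\<lambda>lt q. coeff (P q (fst lt) mod D) (snd lt)"] by (auto simp: M_def)
  have "D dvd (\<Sum>q\<le>M. smult (c q) (P q l))" if l: "l \<in> I" for l
  proof -
    have "(\<Sum>q\<le>M. smult (c q) (P q l mod D)) = 0"
    proof (rule poly_eqI)
      fix t
      show "coeff (\<Sum>q\<le>M. smult (c q) (P q l mod D)) t = coeff 0 t"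
      proof (cases "t < degree D")
        case True
        then show ?thesis using c(2)[of "(l, t)"] l by (simp add: I'_def coeff_sum mult.commute)
      next
        case False
        have "coeff (P q l mod D) t = 0" for q
          using degree_mod_less[OF assms, of "P q l"] False by (auto intro: coeff_eq_0)
        then show ?thesis by (simp add: coeff_sum)
      qed
    qed
    moreover have "(\<Sum>q\<le>M. smult (c q) (P q l)) - (\<Sum>q\<le>M. smult (c q) (P q l mod D)) =
        D * (\<Sum>q\<le>M. smult (c q) (P q l div D))"
      unfolding sum_subtractf[symmetric] smult_diff_right[symmetric] minus_mod_eq_mult_div
        sum_distrib_left mult_smult_right ..
    ultimately have "(\<Sum>q\<le>M. smult (c q) (P q l)) = D * (\<Sum>q\<le>M. smult (c q) (P q l div D))"
      by simp
    then show ?thesis by simp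
  qed
  then obtain V where V: "\<And>l. l \<in> I \<Longrightarrow> (\<Sum>q\<le>M. smult (c q) (P q l)) = D * V l"
    unfolding dvd_def by metis
  have to_fract_smult: "S (smult a x) = S [:a:] * S x" for a x
    by (simp flip: s.hom_mult to_fract_mult)
  have "(\<Sum>q\<le>M. S [:c q:] * j f ^ q) = (\<Sum>l\<in>I. (\<Sum>q\<le>M. S (smult (c q) (P q l))) * j (r l))"
    unfolding gP sum_distrib_left sum_distrib_right to_fract_smult mult.assoc[symmetric]
    by (rule sum.swap)
  also have "\<dots> = (\<Sum>l\<in>I. S (D * V l) * j (r l))"
    by (intro sum.cong refl) (simp add: V flip: s.hom_sum to_fract_sum del: to_fract_mult)
  also have "\<dots> = S D * j (\<Sum>l\<in>I. skew_times \<sigma> (ce (V l)) (r l))"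
    by (simp add: j_sum j_times sum_distrib_left mult.assoc s.hom_mult flip: S_eq)
  finally show ?thesis using c(1) that by blast
qed

text \<open>Let \<open>m\<close> be the least index with nonzero coefficient in the relation modulo
  \<open>D\<close>. Since D lies in R f^(m+1), the relation places c_m f^m in R f^(m+1); cancelling
  f^m in B leaves the nonzero constant c_m in R f.\<close>

lemma norm_unit_imp_left_inverse:
  assumes y: "y * j f = 1" and c: "N (j f) = to_fract c" "c dvd 1"
  shows "\<exists>w. j w * j f = 1"
proof -
  obtain D where D: "D \<noteq> 0" "\<And>q. S D * y ^ q \<in> range j"
    using inverse_powers_bounded_denominator[OF y c] by blast
  obtain c M w where c: "\<exists>q\<le>M. c q \<noteq> 0" and rel: "(\<Sum>q\<le>M. S [:c q:] * j f ^ q) = S D * j w"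
    by (rule linear_dependence_of_powers[OF D(1)])
  have yf: "y ^ q * j f ^ q = 1" for q
  proof (induction q)
    case (Suc q)
    have "y ^ Suc q * j f ^ Suc q = y ^ q * (y * j f) * j f ^ q"
      by (simp only: power_Suc2[of y] power_Suc[of "j f"] mult.assoc)
    then show ?case using Suc y by simp
  qed simp
  then have fy: "j f ^ q * y ^ q = 1" for q by (rule left_inverse_imp_right_inverse)
  define m where "m = (LEAST q. c q \<noteq> 0)"
  have c0: "c q = 0" if "q < m" for q
    using that not_less_Least[of q "\<lambda>q. c q \<noteq> 0"] by (auto simp: m_def)
  obtain q0 where q0: "q0 \<le> M" "c q0 \<noteq> 0" using c by blast
  have cm: "c m \<noteq> 0" unfolding m_def using q0(2) by (rule LeastI)
  have "m \<le> q0" unfolding m_def using q0(2) by (rule Least_le)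
  with q0(1) have "m \<le> M" by simp
  have "\<exists>g. j f ^ q = j g" for q by (rule j_power[of f q]) metis
  then obtain g where g: "\<And>q. j f ^ q = j (g q)" by metis
  obtain x where x: "S D * y ^ Suc m = j x" using D(2) by blast
  \<comment> \<open>The left cofactor of f^(m+1) in the terms of index above
    \<open>m\<close>.\<close>
  define X where "X = (\<Sum>q\<in>{m<..M}. skew_times \<sigma> [:\<iota> (c q):] (g (q - Suc m)))"
  have X: "(\<Sum>q\<in>{m<..M}. S [:c q:] * j f ^ q) = j X * j f ^ Suc m"
  proof -
    have "S [:c q:] * j f ^ q = j (skew_times \<sigma> [:\<iota> (c q):] (g (q - Suc m))) * j f ^ Suc m"
      if "q \<in> {m<..M}" for q
    proof -
      have "j f ^ q = j f ^ (q - Suc m) * j f ^ Suc m"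
        using that by (simp del: power_Suc flip: power_add)
      then show ?thesis by (simp add: j_times S_const mult.assoc flip: g)
    qed
    then show ?thesis unfolding X_def j_sum sum_distrib_right by (intro sum.cong refl)
  qed
  \<comment> \<open>Centrality of \<open>D\<close> in R moves it to the right of \<open>w\<close>,
    where it splits off f^(m+1).\<close>
  have "S D * j w = j w * (S D * (y ^ Suc m * j f ^ Suc m))"
    unfolding yf S_commute by simp
  also have "\<dots> = j w * j x * j f ^ Suc m"
    unfolding x[symmetric] by (simp only: mult.assoc)
  finally have "S D * j w = j w * j x * j f ^ Suc m" .
  moreover have "(\<Sum>q\<le>M. S [:c q:] * j f ^ q) = (\<Sum>q\<in>{m..M}. S [:c q:] * j f ^ q)"
    by (rule sum.mono_neutral_right) (auto simp: c0)
  moreover have "(\<Sum>q\<in>{m..M}. S [:c q:] * j f ^ q) =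
      S [:c m:] * j f ^ m + (\<Sum>q\<in>{m<..M}. S [:c q:] * j f ^ q)"
    using \<open>m \<le> M\<close> by (rule sum.head)
  ultimately have "S [:c m:] * j f ^ m = (j w * j x - j X) * j f ^ Suc m"
    using rel X by (simp add: algebra_simps del: power_Suc)
  then have "S [:c m:] * (j f ^ m * y ^ m) = (j w * j x - j X) * j f * (j f ^ m * y ^ m)"
    by (metis mult.assoc power_Suc)
  then have *: "S [:c m:] = (j w * j x - j X) * j f" unfolding fy by simp
  have "[:inverse (c m):] * [:c m:] = 1" using cm by (simp add: one_pCons)
  then have "1 = S ([:inverse (c m):] * [:c m:])" by (simp only: to_fract_1 s.hom_one)
  also have "\<dots> = S [:inverse (c m):] * ((j w * j x - j X) * j f)"
    unfolding to_fract_mult s.hom_mult * ..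
  also have "\<dots> = j (skew_times \<sigma> [:\<iota> (inverse (c m)):] (skew_times \<sigma> w x - X)) * j f"
    by (simp add: j_times j_diff S_const mult.assoc)
  finally show ?thesis by metis
qed

section \<open>From irreducible h to irreducible f\<close>

lemma norm_dvd_power:
  assumes "j a * j f * j b = S h"
  obtains p where "N (j f) = to_fract p" "p dvd h ^ k" "n * degree p \<le> k * degree f"
proof -
  obtain pf where pf: "N (j f) = to_fract pf" "n * degree pf \<le> k * degree f" by (rule norm_polynomial)
  obtain pa where pa: "N (j a) = to_fract pa" by (rule norm_polynomial)
  obtain pb where pb: "N (j b) = to_fract pb" by (rule norm_polynomial)
  \<comment> \<open>The central \<open>h\<close> acts as a scalar matrix, so its norm is
    \<open>h ^ k\<close>.\<close>
  have "to_fract (h ^ k) = to_fract (pf * (pa * pb))"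
    using arg_cong[OF assms, of N] by (simp add: N_mult N_s pa pb pf(1) to_fract_power ac_simps)
  then have "h ^ k = pf * (pa * pb)" by (simp only: to_fract_eq_iff)
  then show ?thesis using pf that by simp
qed

lemma skew_irreducible_if_irreducible:
  assumes irr: "irreducible h" and hf: "is_min_central_left_multiple \<sigma> \<iota> u n f h"
    and deg: "degree h = d * degree f" and k: "k = d * n"
  shows "skew_irreducible \<sigma> f"
proof -
  have h0: "h \<noteq> 0" using irr by (simp add: irreducible_def)
  have "\<not> is_unit h" using irr by (simp add: irreducible_def)
  then have degh: "degree h > 0" using h0 by (simp add: is_unit_iff_degree)
  \<comment> \<open>A left inverse in R would make 1 a central left multiple of \<open>f\<close>, of
    smaller degree than the minimal one.\<close>
  have not_left_inv: "j w * j f \<noteq> 1" for w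
  proof
    assume "j w * j f = 1"
    then have "right_divides \<sigma> f (ce 1)"
      unfolding right_divides_iff S_eq[symmetric] by auto
    then have "degree (ce h) \<le> degree (ce 1)"
      using hf unfolding is_min_central_left_multiple_def by simp
    then show False using degh n_pos by (simp add: degree_ce)
  qed
  obtain a where a: "S h = j a * j f"
    using hf unfolding is_min_central_left_multiple_def right_divides_iff S_eq by blast
  have S_inv: "s (inverse (to_fract h)) * S h = 1"
    using h0 by (simp flip: s.hom_mult)
  then have inv: "(s (inverse (to_fract h)) * j a) * j f = 1" by (simp add: a mult.assoc)
  have d: "d > 0" using deg degh by (cases d) auto
  \<comment> \<open>The norm of such a factor divides \<open>h ^ k\<close>, but its degree is too
    small for \<open>h\<close> to divide it, so it is a unit.\<close>
  have small: "\<exists>p. N (j g) = to_fract p \<and> p dvd 1"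
    if g: "j b * j g * j c = S h" "degree g < degree f" for b g c
  proof -
    obtain p where p: "N (j g) = to_fract p" "p dvd h ^ k" "n * degree p \<le> k * degree g"
      using norm_dvd_power[OF g(1)] by blast
    have "n * degree p \<le> n * (d * degree g)" using p(3) k by (simp add: ac_simps)
    then have "degree p \<le> d * degree g" using n_pos by simp
    also have "\<dots> < degree h" using g(2) d deg by simp
    finally have less: "degree p < degree h" .
    have "p \<noteq> 0" using p(2) h0 by auto
    then have "\<not> h dvd p" using less by (auto dest: dvd_imp_degree_le)
    moreover have "prime_elem h" using irr by (rule field_poly_irreducible_imp_prime)
    ultimately show ?thesis using prime_elem_power_cofactor p(1,2) by blast
  qed
  show ?thesis
    unfolding skew_irreducible_def
  proof (intro conjI notI)
    assume "skew_unit \<sigma> f"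
    then obtain w where "skew_times \<sigma> w f = [:1:]" by (auto simp: skew_unit_def)
    then have "j w * j f = 1" by (metis j_times j_1)
    then show False using not_left_inv by blast
  next
    assume "\<exists>g q. f = skew_times \<sigma> g q \<and>
      1 \<le> degree g \<and> degree g < degree f \<and> 1 \<le> degree q \<and> degree q < degree f"
    then obtain g q where gq: "f = skew_times \<sigma> g q" "degree g < degree f" "degree q < degree f" by blast
    have f: "j f = j g * j q" unfolding gq(1) j_times ..
    obtain pg where pg: "N (j g) = to_fract pg" "pg dvd 1"
      using small[of a g q] gq(2) a f by (auto simp: mult.assoc)
    obtain pq where pq: "N (j q) = to_fract pq" "pq dvd 1"
      using small[of "skew_times \<sigma> a g" q "[:1:]"] gq(3) a f by (auto simp: mult.assoc j_times j_1)
    \<comment> \<open>Both factors have unit norm, hence so does \<open>f\<close>, and 1 would lie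
      in R f.\<close>
    have "N (j f) = to_fract (pg * pq)" by (simp add: f N_mult pg pq)
    moreover have "pg * pq dvd 1" using mult_dvd_mono[OF pg(2) pq(2)] by simp
    ultimately show False using norm_unit_imp_left_inverse[OF inv] not_left_inv by blast
  qed
qed

end

section \<open>Division algebras\<close>

context central_quotient
begin

lemma right_division:
  assumes div: "is_division_ring TYPE('a)" and r: "r \<noteq> 0"
  obtains q w where "f = skew_times \<sigma> q r + w" "w = 0 \<or> degree w < degree r"
proof -
  have "\<exists>q w. j f = j q * j r + j w \<and> (w = 0 \<or> degree w < degree r)"
  proof (induction "degree f" arbitrary: f rule: less_induct)
    case less
    show ?case
    proof (cases "f = 0 \<or> degree f < degree r")
      case True
      then show ?thesis by (intro exI[of _ 0] exI[of _ f]) (simp add: j_0)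
    next
      case False
      define l where "l = degree f - degree r"
      have l: "degree f = l + degree r" using False by (simp add: l_def)
      \<comment> \<open>Injectivity of \<open>\<sigma>\<close> keeps the twisted leading coefficient
        nonzero, hence invertible.\<close>
      have "(\<sigma> ^^ l) (lead_coeff r) \<noteq> 0"
      proof -
        have "inj (\<sigma> ^^ l)" using \<sigma>_automorphism by (simp add: ring_automorphism_def bij_is_inj inj_fn)
        then show ?thesis using r by (metis \<sigma>_pow_0 injD leading_coeff_0_iff)
      qed
      then obtain b where b: "b * (\<sigma> ^^ l) (lead_coeff r) = 1"
        using div unfolding is_division_ring_def ring_unit_def by blast
      \<comment> \<open>Chosen so that the product of \<open>g\<close> and \<open>r\<close> has the
        leading term of \<open>f\<close>.\<close>
      define g where "g = monom (lead_coeff f * b) l"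
      define f' where "f' = f - skew_times \<sigma> g r"
      have "lead_coeff f * b \<noteq> 0"
      proof
        assume "lead_coeff f * b = 0"
        then have "lead_coeff f * (b * (\<sigma> ^^ l) (lead_coeff r)) = 0" by (simp flip: mult.assoc)
        then show False using b False by simp
      qed
      then have g: "degree g = l" "coeff g l = lead_coeff f * b"
        by (simp_all add: g_def degree_monom_eq)
      have "degree (skew_times \<sigma> g r) \<le> degree f"
        using degree_skew_times_le[of \<sigma> g r] by (simp add: g l)
      then have "degree f' \<le> degree f" unfolding f'_def by (intro degree_diff_le) auto
      moreover have "coeff f' (degree f) = 0"
        using coeff_skew_times_degree_add[of \<sigma> g r] b by (simp add: f'_def g(1) l[symmetric] g(2) mult.assoc)
      ultimately have "f' = 0 \<or> degree f' < degree f" by (rule eq_zero_or_degree_less)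
      then obtain q w where qw: "j f' = j q * j r + j w" "w = 0 \<or> degree w < degree r"
        using less by (metis j_0 add_0 mult_zero_left)
      have "j f = j (q + g) * j r + j w"
        using qw(1) by (simp add: f'_def j_diff j_times j_add algebra_simps)
      then show ?thesis using qw(2) by blast
    qed
  qed
  then show ?thesis using that by (metis j_add j_times j_eq_iff)
qed

lemma degree_skew_times:
  assumes div: "is_division_ring TYPE('a)" and "f \<noteq> 0" "g \<noteq> 0"
  shows "degree (skew_times \<sigma> f g) = degree f + degree g"
proof -
  have "inj (\<sigma> ^^ degree f)" using \<sigma>_automorphism by (simp add: ring_automorphism_def bij_is_inj inj_fn)
  then have "(\<sigma> ^^ degree f) (lead_coeff g) \<noteq> 0"
    using assms(3) by (metis \<sigma>_pow_0 injD leading_coeff_0_iff)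
  then obtain b where "(\<sigma> ^^ degree f) (lead_coeff g) * b = 1"
    using div unfolding is_division_ring_def ring_unit_def by blast
  then have "lead_coeff f * (\<sigma> ^^ degree f) (lead_coeff g) \<noteq> 0"
    using assms(2) by (metis leading_coeff_0_iff mult.assoc mult.right_neutral mult_zero_left)
  then have "coeff (skew_times \<sigma> f g) (degree f + degree g) \<noteq> 0"
    by (simp add: coeff_skew_times_degree_add)
  then show ?thesis using degree_skew_times_le le_degree le_antisym by metis
qed

lemma left_inverse_of_degree_0:
  assumes div: "is_division_ring TYPE('a)" and "f \<noteq> 0" "degree f = 0"
  obtains g where "j g * j f = 1" "j f * j g = 1"
proof -
  obtain a where a: "f = [:a:]" using assms(3) by (rule degree_eq_zeroE)
  then obtain b where "a * b = 1" "b * a = 1"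
    using div assms(2) unfolding is_division_ring_def ring_unit_def by auto
  then have "j [:b:] * j f = 1" "j f * j [:b:] = 1"
    using j_monom_times[of a 0 b 0] j_monom_times[of b 0 a 0] by (simp_all add: a j_1 monom_0)
  then show ?thesis by (rule that)
qed

text \<open>The left ideal R p2 + R f is principal, generated by some \<open>r\<close>, and f = g r.
  By irreducibility \<open>r\<close> or \<open>g\<close> is constant, hence a unit: the ideal is R,
  which puts p1 into R f, or it is R f, which contains p2.\<close>

lemma central_factor_in_maximal_left_ideal:
  assumes div: "is_division_ring TYPE('a)" and irr: "skew_irreducible \<sigma> f" and f0: "f \<noteq> 0"
    and a: "S (p1 * p2) = j a * j f"
  shows "(\<exists>b. S p1 = j b * j f) \<or> (\<exists>b. S p2 = j b * j f)"
proof -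
  define I where "I = {r. \<exists>x y. j r = j x * S p2 + j y * j f}"
  have "j f = j 0 * S p2 + j [:1:] * j f" by (simp add: j_0 j_1)
  then have fI: "f \<in> I" unfolding I_def by blast
  have "S p2 = j [:1:] * S p2 + j 0 * j f" by (simp add: j_0 j_1)
  then have p2I: "ce p2 \<in> I" unfolding I_def S_eq by blast
  obtain r where r: "r \<in> I" "r \<noteq> 0" and least: "\<And>r'. r' \<in> I \<Longrightarrow> r' \<noteq> 0 \<Longrightarrow> degree r \<le> degree r'"
    using ex_has_least_nat[of "\<lambda>r. r \<in> I \<and> r \<noteq> 0" f degree] fI f0 by blast
  obtain x y where xy: "j r = j x * S p2 + j y * j f" using r(1) unfolding I_def by blast
  have ideal: "\<exists>q. g = skew_times \<sigma> q r" if gI: "g \<in> I" for g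
  proof -
    obtain q w where qw: "g = skew_times \<sigma> q r + w" "w = 0 \<or> degree w < degree r"
      by (rule right_division[OF div r(2)])
    obtain x' y' where xy': "j g = j x' * S p2 + j y' * j f" using gI unfolding I_def by blast
    have "j w = j g - j q * j r" unfolding qw(1) by (simp add: j_add j_times)
    also have "\<dots> = j (x' - skew_times \<sigma> q x) * S p2 + j (y' - skew_times \<sigma> q y) * j f"
      unfolding xy' xy by (simp add: j_diff j_times algebra_simps)
    finally have "w \<in> I" unfolding I_def by blast
    then have "w = 0" using least[of w] qw(2) by fastforce
    then show ?thesis using qw(1) by auto
  qed
  obtain g where g: "f = skew_times \<sigma> g r" using ideal[OF fI] by blast
  obtain c where c: "ce p2 = skew_times \<sigma> c r" using ideal[OF p2I] by blast
  have "g \<noteq> 0" using g f0 by (metis j_0 j_eq_iff j_times mult_zero_left)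
  then have deg: "degree f = degree g + degree r"
    using degree_skew_times[OF div] r(2) by (simp add: g)
  have "degree r = 0 \<or> degree g = 0"
    using irr g deg unfolding skew_irreducible_def
    by (metis Suc_leI One_nat_def add_less_cancel_left add_less_cancel_right add_0 add.right_neutral neq0_conv)
  then show ?thesis
  proof
    assume "degree r = 0"
    then obtain r' where r': "j r' * j r = 1" using left_inverse_of_degree_0[OF div r(2)] by blast
    \<comment> \<open>Multiplying an expression of 1 in the ideal by p1 and moving p1 next to p2
      produces p1 p2, a left multiple of \<open>f\<close>.\<close>
    have "S p1 = S p1 * (j r' * j r)" by (simp add: r')
    also have "\<dots> = j (skew_times \<sigma> r' x) * (S p1 * S p2) + S p1 * (j r' * j y * j f)"
      unfolding xy by (simp add: j_times distrib_left flip: mult.assoc) (metis S_commute mult.assoc)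
    also have "S p1 * S p2 = j a * j f" using a by (simp add: s.hom_mult)
    finally have "S p1 = j (skew_times \<sigma> (skew_times \<sigma> r' x) a +
        skew_times \<sigma> (ce p1) (skew_times \<sigma> r' y)) * j f"
      by (simp add: j_times j_add S_eq algebra_simps)
    then show ?thesis by blast
  next
    assume "degree g = 0"
    then obtain g' where g': "j g' * j g = 1" using left_inverse_of_degree_0[OF div \<open>g \<noteq> 0\<close>] by blast
    have "j r = (j g' * j g) * j r" by (simp add: g')
    also have "\<dots> = j g' * j f" by (simp add: g j_times mult.assoc)
    finally have "S p2 = j (skew_times \<sigma> c g') * j f" unfolding S_eq c by (simp add: j_times mult.assoc)
    then show ?thesis by blast
  qed
qed

text \<open>In any factorisation of \<open>h\<close> one factor is itself a central left multiple of
  \<open>f\<close>. By minimality it has the degree of \<open>h\<close>, so the other factor is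
  constant.\<close>

lemma irreducible_min_central_left_multiple:
  assumes div: "is_division_ring TYPE('a)" and irr: "skew_irreducible \<sigma> f" and f0: "f \<noteq> 0"
    and h: "is_min_central_left_multiple \<sigma> \<iota> u n f h" and deg: "degree h > 0"
  shows "irreducible h"
proof (rule irreducibleI)
  show h0: "h \<noteq> 0" using deg by auto
  show "\<not> is_unit h" using deg h0 by (simp add: is_unit_iff_degree)
  fix p1 p2 assume p: "h = p1 * p2"
  then have p0: "p1 \<noteq> 0" "p2 \<noteq> 0" using h0 by auto
  have degp: "degree h = degree p1 + degree p2" using p0 by (simp add: p degree_mult_eq)
  obtain a where "S (p1 * p2) = j a * j f"
    using h unfolding is_min_central_left_multiple_def right_divides_iff S_eq[symmetric] p by blast
  then have *: "(\<exists>b. S p1 = j b * j f) \<or> (\<exists>b. S p2 = j b * j f)"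
    by (rule central_factor_in_maximal_left_ideal[OF div irr f0])
  have le: "degree h \<le> degree q" if q: "q \<noteq> 0" "S q = j b * j f" for q b
  proof -
    \<comment> \<open>Minimality compares monic polynomials, so \<open>q\<close> is normalised
      first.\<close>
    define q' where "q' = smult (inverse (lead_coeff q)) q"
    have "S q' = S [:inverse (lead_coeff q):] * S q"
      unfolding q'_def by (simp flip: s.hom_mult to_fract_mult)
    then have "j (ce q') = j (skew_times \<sigma> (ce [:inverse (lead_coeff q):]) b) * j f"
      using q(2) by (simp add: j_times mult.assoc flip: S_eq)
    then have "right_divides \<sigma> f (ce q')" unfolding right_divides_iff by blast
    moreover have "lead_coeff q' = 1" using q(1) by (simp add: q'_def)
    ultimately have "degree (ce h) \<le> degree (ce q')"
      using h unfolding is_min_central_left_multiple_def by blast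
    then show ?thesis using n_pos q(1) by (simp add: degree_ce q'_def)
  qed
  from * have "degree p2 = 0 \<or> degree p1 = 0"
  proof (elim disjE exE)
    fix b assume "S p1 = j b * j f"
    then show ?thesis using le[OF p0(1)] degp by fastforce
  next
    fix b assume "S p2 = j b * j f"
    then show ?thesis using le[OF p0(2)] degp by fastforce
  qed
  then show "is_unit p1 \<or> is_unit p2" using p0 by (auto simp: is_unit_iff_degree)
qed

end

section \<open>From irreducible f to irreducible norm\<close>

context split_central_quotient
begin

lemma norm_irreducible_if_skew_irreducible:
  assumes div: "is_division_ring TYPE('a)" and irr: "skew_irreducible \<sigma> f" and f0: "f \<noteq> 0"
    and h: "is_min_central_left_multiple \<sigma> \<iota> u n f h"
    and deg: "degree h = d * degree f" and k: "k = d * n" and d: "d > 0"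
  shows "\<exists>p. N (j f) = to_fract p \<and> irreducible p"
proof -
  \<comment> \<open>Over a division ring a nonzero constant is a unit, and units are
    excluded.\<close>
  have "degree f > 0"
  proof (rule ccontr)
    assume "\<not> degree f > 0"
    then obtain g where "j g * j f = 1" "j f * j g = 1"
      using left_inverse_of_degree_0[OF div f0] by blast
    then have "skew_unit \<sigma> f" unfolding skew_unit_def by (metis j_1 j_eq_iff j_times)
    then show False using irr by (simp add: skew_irreducible_def)
  qed
  then have degh: "degree h > 0" using deg d by simp
  then have h0: "h \<noteq> 0" by auto
  have irrh: "irreducible h" by (rule irreducible_min_central_left_multiple[OF div irr f0 h degh])
  obtain a where a: "S h = j a * j f"
    using h unfolding is_min_central_left_multiple_def right_divides_iff S_eq by blast
  then have ce: "ce h = skew_times \<sigma> a f" by (simp add: S_eq j_eq_iff flip: j_times)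
  have "a \<noteq> 0"
  proof
    assume "a = 0"
    then have "S h = S 0" using a by (simp add: j_0)
    then have "degree (ce h) = degree (ce 0)" unfolding S_eq j_eq_iff by simp
    then show False using degh n_pos by (simp add: degree_ce)
  qed
  then have dega: "n * degree h = degree a + degree f"
    using degree_skew_times[OF div _ f0] by (simp add: ce flip: degree_ce)
  obtain p where p: "N (j f) = to_fract p" "n * degree p \<le> k * degree f" by (rule norm_polynomial)
  obtain q where q: "N (j a) = to_fract q" "n * degree q \<le> k * degree a" by (rule norm_polynomial)
  have "to_fract (h ^ k) = to_fract (q * p)"
    using arg_cong[OF a, of N] by (simp add: N_mult N_s p(1) q(1) to_fract_power)
  then have hk: "h ^ k = q * p" by (simp only: to_fract_eq_iff)
  then have qp: "q \<noteq> 0" "p \<noteq> 0" using h0 by (metis mult_zero_left mult_zero_right power_not_zero)+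
  have "degree q + degree p = k * degree h"
    using arg_cong[OF hk, of degree] qp h0 by (simp add: degree_mult_eq degree_power_eq)
  then have "n * degree q + n * degree p = k * degree a + k * degree f"
    using dega by (metis distrib_left mult.left_commute)
  \<comment> \<open>The upper bounds for the norms of \<open>a\<close> and \<open>f\<close> add up
    to the exact degree of \<open>h ^ k\<close>, so both are attained.\<close>
  then have "k * degree f \<le> n * degree p" using q(2) by linarith
  then have "n * degree p = k * degree f" using p(2) by simp
  also have "\<dots> = n * degree h" by (simp add: deg k)
  finally have "n * degree p = n * degree h" .
  then have degp: "degree p = degree h" using n_pos by simp
  then have "\<not> p dvd 1" using degh qp by (simp add: is_unit_iff_degree)
  moreover have "p dvd h ^ k" using hk by simp
  ultimately have "h dvd p"
    using prime_elem_power_cofactor[OF field_poly_irreducible_imp_prime[OF irrh]] by blast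
  then obtain c where c: "p = h * c" ..
  \<comment> \<open>Equal degrees make the cofactor a nonzero constant, so the norm is associated to
    \<open>h\<close>.\<close>
  then have "degree c = 0" "c \<noteq> 0" using degp qp h0 by (auto simp: degree_mult_eq)
  then have "is_unit c" by (simp add: is_unit_iff_degree)
  then have "irreducible p" using irrh by (simp add: c irreducible_mult_unit_right)
  then show ?thesis using p(1) by blast
qed

end

section \<open>The two implications for the cyclic algebra\<close>

theorem theorem14:
  fixes E C :: "'a::ring_1 set"
    and \<gamma> \<sigma> :: "'a \<Rightarrow> 'a"
    and a e u :: 'a
    and d n m :: nat
    and \<iota> :: "'f::field \<Rightarrow> 'a"
    and j :: "'a poly \<Rightarrow> 'b::ring_1"
    and s :: "'f poly fract \<Rightarrow> 'b"
    and N :: "'b \<Rightarrow> 'f poly fract"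
    and f :: "'a poly"
    and hh :: "'f poly"
  assumes "cyclic_algebra E C \<gamma> d a e"
    and "ring_automorphism \<sigma>"
    and "order_mod_inner \<sigma> n"
    and "order_on C \<sigma> n"
    and "Ring_Hom.ring_hom \<iota>" and "range \<iota> = C \<inter> {b. \<sigma> b = b}"
    and "ring_unit u" and "\<forall>z. (\<sigma> ^^ n) z = u * z * ring_inv u" and "\<sigma> u = u"
    and "\<sigma> ` E = E"
    and "u \<in> E"
    and "\<forall>z\<in>E. \<gamma> (\<sigma> z) = \<sigma> (\<gamma> z)"
    and "is_central_quotient_ring \<sigma> \<iota> u n j s"
    and "is_reduced_norm TYPE('k::field) s (d * n) N"
    and "f \<noteq> 0" and "degree f = m"
    and "is_gcrd \<sigma> f (monom 1 1) [:1:]"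
    and "is_min_central_left_multiple \<sigma> \<iota> u n f hh"
    and "degree hh = d * m"
  shows "(irreducible hh \<longrightarrow> skew_irreducible \<sigma> f) \<and>
         (is_division_ring TYPE('a) \<longrightarrow> skew_irreducible \<sigma> f \<longrightarrow>
            (\<exists>p. N (j f) = to_fract p \<and> irreducible p))"
proof -
  have sub: "is_subfield E" "C \<subseteq> E" "\<gamma> \<in> Gal E C" and e: "\<forall>z\<in>E. e * z = \<gamma> z * e"
    and basis: "left_basis E UNIV d (\<lambda>i. e ^ i)"
    using assms(1) unfolding cyclic_algebra_def cyclic_galois_def by blast+
  have span: "\<exists>c. (\<forall>i<d. c i \<in> E) \<and> z = (\<Sum>i<d. c i * e ^ i)" for z
    using basis[unfolded left_basis_def, THEN conjunct2, THEN bspec, OF UNIV_I, of z]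
    by (elim ex1E conjE) blast
  \<comment> \<open>An element of C commutes with E and, being fixed by \<open>\<gamma>\<close>,
    with \<open>e\<close>; these generate A.\<close>
  have central: "c * z = z * c" if c: "c \<in> C" for c z
  proof -
    have "\<gamma> c = c" using sub(3) c by (simp add: Gal_def)
    then have "e * c = c * e" using e c sub(2) by force
    then have ec: "e ^ i * c = c * e ^ i" for i
      by (induction i) (simp_all add: mult.assoc, simp flip: mult.assoc)
    have cE: "c * x = x * c" if "x \<in> E" for x
      using sub(1,2) c that unfolding is_subfield_def by blast
    obtain x where x: "\<forall>i<d. x i \<in> E" "z = (\<Sum>i<d. x i * e ^ i)" using span by blast
    have "c * (x i * e ^ i) = x i * e ^ i * c" if "i < d" for i
      using cE[of "x i"] x(1) that ec[of i] by (metis mult.assoc)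
    then show ?thesis unfolding x(2) sum_distrib_left sum_distrib_right by (intro sum.cong) auto
  qed
  \<comment> \<open>For d = 0 the empty basis would give 1 = 0.\<close>
  have d: "d > 0"
  proof (rule ccontr)
    assume "\<not> d > 0"
    then show False using span[of 1] by simp
  qed
  obtain i :: "'f poly fract \<Rightarrow> 'k" and \<phi> where
    i: "is_splitting s (d * n) i \<phi>" "\<forall>y. i (N y) = det (\<phi> y)"
    using assms(14) unfolding is_reduced_norm_def by blast
  have \<iota>: "\<iota> c \<in> C" "\<sigma> (\<iota> c) = \<iota> c" for c using assms(6) by blast+
  interpret split_central_quotient \<sigma> \<iota> u n j s "d * n" i \<phi> N
  proof (intro split_central_quotient.intro central_quotient.intro split_central_quotient_axioms.intro)
    show "0 < n" using assms(3) by (simp add: order_mod_inner_def)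
  qed (use assms i \<iota> central in auto)
  show ?thesis
    using skew_irreducible_if_irreducible norm_irreducible_if_skew_irreducible assms d by blast
qed

end
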